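(* (Optimality of independent inputs.) Consider a compound memoryless channel. Let $\boldsymbol{X}$ and $\boldsymbol{Y}$ be its input and output sequences, and let $\tilde{\boldsymbol{X}},\tilde{\boldsymbol{Y}}$ be sequences of independent symbols with the same per-symbol statistics as those of $\boldsymbol{X}$ and $\boldsymbol{Y}$. Assume that $$\lim_{n\to\infty}\sup_s\sigma_{ns}^2=0,$$ where $\sigma_{ns}^2$ is the variance of the information density rate under independent inputs: $$\sigma_{ns}^2=\mathsf{var}\Big\{\frac1n\sum_{i=1}^n\ln\frac{p_s(\tilde Y_i|\tilde X_i)}{p_s(\tilde Y_i)}\Big\}.$$ Then $$\underline{\underline{I}}(\boldsymbol{X};\boldsymbol{Y})\le\underline{\underline{I}}(\tilde{\boldsymbol{X}};\tilde{\boldsymbol{Y}}),$$ i.e. independent signaling is optimal, and the compound channel capacity is $$C_c=\sup_{p(\tilde{\boldsymbol{x}})}\underline{\underline{I}}(\tilde{\boldsymbol{X}};\tilde{\boldsymbol{Y}})=\liminf_{n\to\infty}\ \sup_{p(\tilde x^n)}\ \inf_s\ \frac1n\sum_{k=1}^n I(\tilde X_k;\tilde Y_k|s),$$ where $I(X_k;Y_k|s)=E\{i(X_k;Y_k|s)\}$ is the $k$-th symbol mutual information and $p(\tilde x^n)=\prod_{k=1}^n p_k(\tilde x_k)$ is a memoryless input.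
   Context: A compound channel is, for each blocklength $n$ and each state $s$ in an arbitrary set $\mathcal{S}$, a transition probability $p_s(y^n|x^n)$. It is memoryless if, for every $s$ and $n$, $p_s(y^n|x^n)$ is a product over $k=1,\dots,n$ of per-symbol transition probabilities from $x_k$ to $y_k$ (not necessarily the same for all $k$, i.e. not necessarily stationary or information-stable). An input is a sequence $\boldsymbol{X}=\{X^n\}_{n=1}^\infty$ with arbitrary distributions $p(x^n)$ (collectively $p(\boldsymbol{x})$), not depending on $s$; $Y^n$ is the output under state $s$, with distribution $p_s(y^n)$. The information density is $i(x^n;y^n|s)=\ln\frac{p_s(y^n|x^n)}{p_s(y^n)}$ (and likewise $i(x_k;y_k|s)$ per symbol), and the compound inf-information rate is $$\underline{\underline{I}}(\boldsymbol{X};\boldsymbol{Y})=\sup\{R:\lim_{n\to\infty}\sup_{s\in\mathcal{S}}\Pr\{\tfrac1n i(X^n;Y^n|s)\le R\}=0\}.$$ The state is known to the receiver but not the transmitter and is independent of the input; the transmitter knows the set $\mathcal{S}$. The compound capacity $C_c$ is the supremum of rates $R$ for which there is a sequence of codes ($M_n$ codewords not depending on $s$, decision regions possibly depending on $s$, rate $r_n=\frac1n\ln M_n$) with $\liminf_{n\to\infty} r_n\ge R$ and $\sup_{s\in\mathcal{S}}\varepsilon_{ns}\to0$ as $n\to\infty$, where $\varepsilon_{ns}$ is the (maximum or average) error probability under state $s$; in general $C_c=\sup_{p(\boldsymbol{x})}\underline{\underline{I}}(\boldsymbol{X};\boldsymbol{Y})$.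
   Formalization: The capacity clause is unconditional for finite alphabets with average error; otherwise the half C_c ≥ sup I(X;Y) of the quoted general formula is assumed, as it can fail for arbitrary state sets. The sup and capacity clauses assume vanishing variance for every input. *)

theory Defs
  imports "HOL-Probability.Probability"
begin

text \<open>
  The input alphabet is a measurable space \<open>A\<close>. The output alphabet is a measurable space carrying a
  sigma-finite reference measure \<open>B\<close>, and transition probabilities are densities with respect to
  \<open>B\<close> (for blocks: its product). Counting measure gives ordinary transition probabilities,
  Lebesgue measure gives transition probability densities.
  The symbols of a block of length \<open>n\<close> are indexed by \<open>0, \<dots>, n - 1\<close>.
\<close>

definition block :: "'a measure \<Rightarrow> nat \<Rightarrow> (nat \<Rightarrow> 'a) measure" where
  "block M n = PiM {..<n} (\<lambda>_. M)"

definition transition_density :: "'a measure \<Rightarrow> 'b measure \<Rightarrow> ('a \<Rightarrow> 'b \<Rightarrow> real) \<Rightarrow> bool" where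
  "transition_density A B f \<longleftrightarrow>
     (\<lambda>(x, y). f x y) \<in> borel_measurable (A \<Otimes>\<^sub>M B) \<and>
     (\<forall>x\<in>space A. (\<forall>y\<in>space B. 0 \<le> f x y) \<and> (\<integral>\<^sup>+ y. ennreal (f x y) \<partial>B) = 1)"

type_synonym ('s, 'a, 'b) block_channel = "'s \<Rightarrow> nat \<Rightarrow> (nat \<Rightarrow> 'a) \<Rightarrow> (nat \<Rightarrow> 'b) \<Rightarrow> real"

text \<open>\<open>w s n k\<close> is the transition density of the \<open>k\<close>-th symbol in a block of length \<open>n\<close>.\<close>

type_synonym ('s, 'a, 'b) symbol_channel = "'s \<Rightarrow> nat \<Rightarrow> nat \<Rightarrow> 'a \<Rightarrow> 'b \<Rightarrow> real"

definition compound_channel ::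
  "'a measure \<Rightarrow> 'b measure \<Rightarrow> 's set \<Rightarrow> ('s, 'a, 'b) block_channel \<Rightarrow> bool" where
  "compound_channel A B S p \<longleftrightarrow>
     space A \<noteq> {} \<and> sigma_finite_measure B \<and> S \<noteq> {} \<and>
     (\<forall>s\<in>S. \<forall>n. transition_density (block A n) (block B n) (p s n))"

definition memoryless ::
  "'a measure \<Rightarrow> 'b measure \<Rightarrow> 's set \<Rightarrow> ('s, 'a, 'b) block_channel \<Rightarrow>
   ('s, 'a, 'b) symbol_channel \<Rightarrow> bool" where
  "memoryless A B S p w \<longleftrightarrow>
     (\<forall>s\<in>S. \<forall>n. (\<forall>k<n. transition_density A B (w s n k)) \<and>
       (\<forall>x\<in>space (block A n). \<forall>y\<in>space (block B n).
          p s n x y = (\<Prod>k<n. w s n k (x k) (y k))))"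

text \<open>The distributions for different block lengths are not required to be consistent.\<close>

definition inputs :: "'a measure \<Rightarrow> (nat \<Rightarrow> (nat \<Rightarrow> 'a) measure) set" where
  "inputs A = {X. \<forall>n. X n \<in> space (prob_algebra (block A n))}"

definition symbol_dists :: "'a measure \<Rightarrow> nat \<Rightarrow> (nat \<Rightarrow> 'a measure) set" where
  "symbol_dists A n = {Q. \<forall>k<n. Q k \<in> space (prob_algebra A)}"

definition memoryless_inputs :: "'a measure \<Rightarrow> (nat \<Rightarrow> (nat \<Rightarrow> 'a) measure) set" where
  "memoryless_inputs A = {X. \<forall>n. \<exists>Q\<in>symbol_dists A n. X n = PiM {..<n} Q}"

definition symbol_marginal :: "'a measure \<Rightarrow> (nat \<Rightarrow> 'a) measure \<Rightarrow> nat \<Rightarrow> 'a measure" where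
  "symbol_marginal A P k = distr P A (\<lambda>x. x k)"

definition independent_version ::
  "'a measure \<Rightarrow> (nat \<Rightarrow> (nat \<Rightarrow> 'a) measure) \<Rightarrow> nat \<Rightarrow> (nat \<Rightarrow> 'a) measure" where
  "independent_version A X n = PiM {..<n} (symbol_marginal A (X n))"

text \<open>Each of the next notions is used both for single symbols and for blocks.\<close>

definition joint_law :: "'a measure \<Rightarrow> 'b measure \<Rightarrow> ('a \<Rightarrow> 'b \<Rightarrow> real) \<Rightarrow> ('a \<times> 'b) measure" where
  "joint_law P B f = density (P \<Otimes>\<^sub>M B) (\<lambda>(x, y). ennreal (f x y))"

definition output_density :: "'a measure \<Rightarrow> ('a \<Rightarrow> 'b \<Rightarrow> real) \<Rightarrow> 'b \<Rightarrow> real" where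
  "output_density P f y = enn2real (\<integral>\<^sup>+ x. ennreal (f x y) \<partial>P)"

text \<open>Points with \<open>f x y = 0\<close> or with output density zero or infinite are null for the joint law.\<close>

definition info_density :: "'a measure \<Rightarrow> ('a \<Rightarrow> 'b \<Rightarrow> real) \<Rightarrow> 'a \<Rightarrow> 'b \<Rightarrow> real" where
  "info_density P f x y = ln (f x y / output_density P f y)"

text \<open>
  Extended-real expectation; for information densities the negative part always has a finite
  integral, so the difference is never of the form infinity minus infinity.
\<close>

definition ext_expectation :: "'a measure \<Rightarrow> ('a \<Rightarrow> real) \<Rightarrow> ereal" where
  "ext_expectation M f =
     enn2ereal (\<integral>\<^sup>+ z. ennreal (f z) \<partial>M) - enn2ereal (\<integral>\<^sup>+ z. ennreal (- f z) \<partial>M)"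

text \<open>
  For a measurable \<open>f\<close> on a probability space this is infinite whenever \<open>f\<close> is not square integrable:
  if \<open>f\<close> is not even integrable, the inner integral is \<open>0\<close> by convention and the outer one is infinite.
\<close>

definition ext_variance :: "'a measure \<Rightarrow> ('a \<Rightarrow> real) \<Rightarrow> ennreal" where
  "ext_variance M f = (\<integral>\<^sup>+ z. ennreal ((f z - (\<integral>z'. f z' \<partial>M))\<^sup>2) \<partial>M)"

definition mutual_info :: "'a measure \<Rightarrow> 'b measure \<Rightarrow> ('a \<Rightarrow> 'b \<Rightarrow> real) \<Rightarrow> ereal" where
  "mutual_info P B f = ext_expectation (joint_law P B f) (\<lambda>(x, y). info_density P f x y)"

definition inf_info_rate ::
  "'b measure \<Rightarrow> 's set \<Rightarrow> ('s, 'a, 'b) block_channel \<Rightarrow> (nat \<Rightarrow> (nat \<Rightarrow> 'a) measure) \<Rightarrow> ereal" where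
  "inf_info_rate B S p X = Sup {ereal R | R.
     (\<lambda>n. SUP s\<in>S. let J = joint_law (X n) (block B n) (p s n) in
        emeasure J {(x, y) \<in> space J. info_density (X n) (p s n) x y / real n \<le> R})
     \<longlonglongrightarrow> 0}"

definition info_rate_variance ::
  "'a measure \<Rightarrow> 'b measure \<Rightarrow> ('s, 'a, 'b) block_channel \<Rightarrow> ('s, 'a, 'b) symbol_channel \<Rightarrow>
   (nat \<Rightarrow> (nat \<Rightarrow> 'a) measure) \<Rightarrow> 's \<Rightarrow> nat \<Rightarrow> ennreal" where
  "info_rate_variance A B p w X s n =
     ext_variance (joint_law (independent_version A X n) (block B n) (p s n))
       (\<lambda>(x, y). (\<Sum>k<n. info_density (symbol_marginal A (X n) k) (w s n k) (x k) (y k)) / real n)"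

text \<open>
  A code of length \<open>n\<close> with \<open>M\<close> codewords \<open>c m\<close>, and decision regions \<open>D s m\<close> that may depend on
  the state; outputs outside all regions are counted as errors.
\<close>

definition is_code ::
  "'a measure \<Rightarrow> 'b measure \<Rightarrow> 's set \<Rightarrow> nat \<Rightarrow> nat \<Rightarrow> (nat \<Rightarrow> nat \<Rightarrow> 'a) \<Rightarrow>
   ('s \<Rightarrow> nat \<Rightarrow> (nat \<Rightarrow> 'b) set) \<Rightarrow> bool" where
  "is_code A B S n M c D \<longleftrightarrow>
     1 \<le> M \<and> (\<forall>m<M. c m \<in> space (block A n)) \<and>
     (\<forall>s\<in>S. (\<forall>m<M. D s m \<in> sets (block B n)) \<and> disjoint_family_on (D s) {..<M})"

datatype error_criterion = Maximum_Error | Average_Error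

definition message_error ::
  "'b measure \<Rightarrow> ('s, 'a, 'b) block_channel \<Rightarrow> 's \<Rightarrow> nat \<Rightarrow> (nat \<Rightarrow> nat \<Rightarrow> 'a) \<Rightarrow>
   ('s \<Rightarrow> nat \<Rightarrow> (nat \<Rightarrow> 'b) set) \<Rightarrow> nat \<Rightarrow> ennreal" where
  "message_error B p s n c D m =
     emeasure (density (block B n) (\<lambda>y. ennreal (p s n (c m) y))) (space (block B n) - D s m)"

fun code_error ::
  "error_criterion \<Rightarrow> 'b measure \<Rightarrow> ('s, 'a, 'b) block_channel \<Rightarrow> 's \<Rightarrow> nat \<Rightarrow> nat \<Rightarrow>
   (nat \<Rightarrow> nat \<Rightarrow> 'a) \<Rightarrow> ('s \<Rightarrow> nat \<Rightarrow> (nat \<Rightarrow> 'b) set) \<Rightarrow> ennreal" where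
  "code_error Maximum_Error B p s n M c D = (SUP m\<in>{..<M}. message_error B p s n c D m)"
| "code_error Average_Error B p s n M c D = (\<Sum>m<M. message_error B p s n c D m) / of_nat M"

definition achievable_rate ::
  "error_criterion \<Rightarrow> 'a measure \<Rightarrow> 'b measure \<Rightarrow> 's set \<Rightarrow> ('s, 'a, 'b) block_channel \<Rightarrow> real \<Rightarrow> bool"
where
  "achievable_rate crit A B S p R \<longleftrightarrow> (\<exists>M c D.
     (\<forall>n. is_code A B S n (M n) (c n) (D n)) \<and>
     ereal R \<le> liminf (\<lambda>n. ereal (ln (real (M n)) / real n)) \<and>
     (\<lambda>n. SUP s\<in>S. code_error crit B p s n (M n) (c n) (D n)) \<longlonglongrightarrow> 0)"

definition compound_capacity ::
  "error_criterion \<Rightarrow> 'a measure \<Rightarrow> 'b measure \<Rightarrow> 's set \<Rightarrow> ('s, 'a, 'b) block_channel \<Rightarrow> ereal" where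
  "compound_capacity crit A B S p = Sup {ereal R | R. achievable_rate crit A B S p R}"

text \<open>
  For arbitrary state sets the direct part of the coding theorem (capacity at least the supremum of
  the inf-information rates) is unconditional for finite alphabets and average error only. Maximum
  error fails for finite alphabets: the input alphabet has three letters, the state merges at each
  position an arbitrary pair of them, so some state confuses any two given codewords, while uniform
  independent inputs have a positive rate. Average error fails for infinite alphabets: the input
  alphabet is the unit interval, the states are all maps to two letters that are balanced for
  Lebesgue measure, so some state is constant on the letters used by any given code.
\<close>

definition finite_alphabets :: "'a measure \<Rightarrow> 'b measure \<Rightarrow> bool" where
  "finite_alphabets A B \<longleftrightarrow>
     finite (space A) \<and> sets A = Pow (space A) \<and>
     finite (space B) \<and> B = count_space (space B)"

end

theory Submission
  imports Defs "HOL-Real_Asymp.Real_Asymp"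
begin

text \<open>
  For a memoryless channel, the information density of a block exceeds the sum of its symbol
  information densities by at most \<open>ln h \<le> h - 1\<close>, where \<open>h\<close> is the product of the symbol output
  densities divided by the block output density; the expectation of \<open>h\<close> is at most \<open>1\<close>. The negative
  part of the information density of a block also has expectation at most \<open>1\<close>. Hence a rate that is
  exceeded with high probability is at most the mean of the symbol mutual informations, up to \<open>O(1 / n)\<close>
  and uniformly in the state. These means depend on the symbol marginals only, and under independent
  inputs the information density rate concentrates on their average by Chebyshev's inequality.

  The converse part of the coding theorem is the bound of Verdu and Han for the uniform distribution on
  the codewords. For the direct part, the success probability of maximum likelihood decoding of a random
  codebook with \<open>M\<close> words has differences bounded by \<open>2 / M\<close>, so it deviates from its mean by \<open>t\<close> with
  probability at most \<open>exp (- M t\<^sup>2 / 16)\<close>. As \<open>M\<close> is exponential in \<open>n\<close>, a union bound over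
  \<open>exp O(n\<^sup>2)\<close> quantised states yields one codebook that is good for all states.
\<close>

section \<open>Information density of a channel\<close>

text \<open>No expectation of an information density is assumed to be finite. The independence half
  therefore rests on one-sided facts: negative parts are integrable for every channel, and the
  variance hypothesis then makes the symbol information densities integrable. In the direct part the
  codebook must serve all states, while averaging over random codebooks only gives a good codebook
  for each state separately. Bounding the mean error and summing over states is hopeless: the tails
  of the information density may vanish arbitrarily slowly, and the quantised states number about
  \<open>exp (C * n^2)\<close>, one \<open>n\<close> from the logarithm of the grid size and one
  from the number of symbol parameters. Separating the mean from the fluctuation is the way out: the
  mean may converge as slowly as it likes, and only the fluctuation has to survive the union bound.
  It does because the average success depends little on any single codeword. Decoding may use the
  state, so it needs no such care.\<close>

lemma transition_densityD:
  assumes "transition_density A B f"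
  shows "(\<lambda>(x, y). f x y) \<in> borel_measurable (A \<Otimes>\<^sub>M B)"
    and "x \<in> space A \<Longrightarrow> y \<in> space B \<Longrightarrow> 0 \<le> f x y"
    and "x \<in> space A \<Longrightarrow> (\<integral>\<^sup>+ y. ennreal (f x y) \<partial>B) = 1"
  using assms unfolding transition_density_def by auto

lemma transition_density_cong_sets:
  fixes A P :: "'a measure" and B :: "'b measure"
  assumes "sets P = sets A" "transition_density A B f"
  shows "transition_density P B f"
proof -
  have "space P = space A"
    using assms(1) by (rule sets_eq_imp_space_eq)
  moreover have "borel_measurable (P \<Otimes>\<^sub>M B) = (borel_measurable (A \<Otimes>\<^sub>M B) :: ('a \<times> 'b \<Rightarrow> real) set)"
    using assms(1) by (intro measurable_cong_sets sets_pair_measure_cong) auto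
  ultimately show ?thesis
    using assms(2) unfolding transition_density_def by simp
qed

text \<open>Instantiated with a symbol marginal, a block input and the uniform distribution on a
  codebook alike; no product structure enters.\<close>

locale channel_law = prob_space P + B: sigma_finite_measure B
  for P :: "'a measure" and B :: "'b measure" +
  fixes f :: "'a \<Rightarrow> 'b \<Rightarrow> real"
  assumes density: "transition_density P B f"
begin

sublocale PB: pair_sigma_finite P B ..

abbreviation "J \<equiv> joint_law P B f"
abbreviation "q \<equiv> output_density P f"
abbreviation "i \<equiv> info_density P f"

lemmas nonneg = transition_densityD(2)[OF density]

lemma measurable_f [measurable]: "(\<lambda>(x, y). f x y) \<in> borel_measurable (P \<Otimes>\<^sub>M B)"
  by (rule transition_densityD(1)[OF density])

lemma measurable_f' [measurable]:
  "g \<in> measurable N P \<Longrightarrow> h \<in> measurable N B \<Longrightarrow> (\<lambda>z. f (g z) (h z)) \<in> borel_measurable N"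
  using measurable_compose[OF measurable_Pair measurable_f, of g N h] by simp

lemma measurable_q [measurable]: "q \<in> borel_measurable B"
  unfolding output_density_def by measurable

lemma measurable_i [measurable]: "(\<lambda>(x, y). i x y) \<in> borel_measurable (P \<Otimes>\<^sub>M B)"
  unfolding info_density_def by measurable

lemma sets_J [simp, measurable_cong]: "sets J = sets (P \<Otimes>\<^sub>M B)"
  unfolding joint_law_def by simp

lemma space_J: "space J = space P \<times> space B"
  unfolding joint_law_def by (simp add: space_pair_measure)

lemma q_nonneg: "0 \<le> q y"
  unfolding output_density_def by simp

lemma nn_integral_J:
  assumes [measurable]: "g \<in> borel_measurable (P \<Otimes>\<^sub>M B)"
  shows "(\<integral>\<^sup>+ z. g z \<partial>J) = (\<integral>\<^sup>+ x. \<integral>\<^sup>+ y. ennreal (f x y) * g (x, y) \<partial>B \<partial>P)"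
proof -
  have "(\<integral>\<^sup>+ z. g z \<partial>J) = (\<integral>\<^sup>+ z. ennreal (case z of (x, y) \<Rightarrow> f x y) * g z \<partial>(P \<Otimes>\<^sub>M B))"
    unfolding joint_law_def by (subst nn_integral_density) (auto simp: case_prod_beta')
  also have "\<dots> = (\<integral>\<^sup>+ x. \<integral>\<^sup>+ y. ennreal (f x y) * g (x, y) \<partial>B \<partial>P)"
    by (subst B.nn_integral_fst[symmetric]) (auto simp: case_prod_beta')
  finally show ?thesis .
qed

lemma nn_integral_J_swap:
  assumes [measurable]: "g \<in> borel_measurable (P \<Otimes>\<^sub>M B)"
  shows "(\<integral>\<^sup>+ z. g z \<partial>J) = (\<integral>\<^sup>+ y. \<integral>\<^sup>+ x. ennreal (f x y) * g (x, y) \<partial>P \<partial>B)"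
  unfolding nn_integral_J[OF assms] by (rule PB.Fubini'[symmetric]) measurable

lemma prob_space_J: "prob_space J"
proof
  have "emeasure J (space J) = (\<integral>\<^sup>+ z. 1 \<partial>J)" by simp
  also have "\<dots> = (\<integral>\<^sup>+ x. \<integral>\<^sup>+ y. ennreal (f x y) \<partial>B \<partial>P)"
    by (subst nn_integral_J) auto
  also have "\<dots> = (\<integral>\<^sup>+ x. 1 \<partial>P)"
    by (intro nn_integral_cong transition_densityD(3)[OF density])
  finally show "emeasure J (space J) = 1" by (simp add: emeasure_space_1)
qed

lemma nn_integral_total: "(\<integral>\<^sup>+ y. \<integral>\<^sup>+ x. ennreal (f x y) \<partial>P \<partial>B) = 1"
proof -
  interpret J: prob_space J by (rule prob_space_J)
  have "(\<integral>\<^sup>+ z. 1 \<partial>J) = 1" by (simp add: J.emeasure_space_1)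
  then show ?thesis by (subst (asm) nn_integral_J_swap) auto
qed

text \<open>\<open>enn2real\<close> sends an infinite output density to 0; the total mass 1 confines
  such outputs to a null set.\<close>

lemma AE_q: "AE y in B. ennreal (q y) = (\<integral>\<^sup>+ x. ennreal (f x y) \<partial>P)"
proof -
  have "AE y in B. (\<integral>\<^sup>+ x. ennreal (f x y) \<partial>P) \<noteq> \<infinity>"
    by (rule nn_integral_PInf_AE) (auto simp: nn_integral_total)
  then show ?thesis
    by eventually_elim (auto simp: output_density_def ennreal_enn2real_if)
qed

lemma nn_integral_q: "(\<integral>\<^sup>+ y. ennreal (q y) \<partial>B) = 1"
  by (subst nn_integral_cong_AE[OF AE_q]) (rule nn_integral_total)

text \<open>The density of \<open>J\<close> vanishes where \<open>f\<close> does, and for almost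
  every output with \<open>q y = 0\<close> its integral over the inputs vanishes. Outside this null
  set the logarithms in the information densities are genuine.\<close>

lemma AE_pos: "AE z in J. 0 < f (fst z) (snd z) \<and> 0 < q (snd z)"
proof -
  have f0: "(\<integral>\<^sup>+ z. indicator {z. f (fst z) (snd z) = 0} z \<partial>J) = 0"
    by (subst nn_integral_J, measurable, subst nn_integral_0_iff_AE)
       (auto intro!: AE_I2 simp: nn_integral_0_iff_AE indicator_def)
  have "(\<integral>\<^sup>+ z. indicator {z. q (snd z) = 0} z \<partial>J)
      = (\<integral>\<^sup>+ y. (\<integral>\<^sup>+ x. ennreal (f x y) \<partial>P) * indicator {y. q y = 0} y \<partial>B)"
    by (subst nn_integral_J_swap, measurable)
       (auto intro!: nn_integral_cong simp: nn_integral_multc[symmetric] indicator_def)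
  also have "\<dots> = (\<integral>\<^sup>+ y. 0 \<partial>B)"
    by (rule nn_integral_cong_AE) (use AE_q in eventually_elim, auto simp: indicator_def)
  finally have q0: "(\<integral>\<^sup>+ z. indicator {z. q (snd z) = 0} z \<partial>J) = 0" by simp
  have "AE z in J. indicator {z. f (fst z) (snd z) = 0} z = (0::ennreal)"
    using f0 by (subst (asm) nn_integral_0_iff_AE) auto
  moreover have "AE z in J. indicator {z. q (snd z) = 0} z = (0::ennreal)"
    using q0 by (subst (asm) nn_integral_0_iff_AE) auto
  ultimately show ?thesis
    using AE_space
  proof eventually_elim
    case (elim z)
    then have "0 \<le> f (fst z) (snd z)" using nonneg by (auto simp: space_J)
    with elim q_nonneg[of "snd z"] show ?case
      by (auto simp: indicator_def less_le split: if_splits)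
  qed
qed

text \<open>The output law of \<open>J\<close> has density \<open>q\<close>, which cancels the
  divisor. Only an inequality, because the mass of \<open>h\<close> on \<open>q = 0\<close> is lost:
  division by zero gives 0 there.\<close>

lemma nn_integral_ratio_q:
  assumes [measurable]: "h \<in> borel_measurable B" and "\<And>y. 0 \<le> h y"
  shows "(\<integral>\<^sup>+ z. ennreal (h (snd z) / q (snd z)) \<partial>J) \<le> (\<integral>\<^sup>+ y. ennreal (h y) \<partial>B)"
proof -
  have "(\<integral>\<^sup>+ z. ennreal (h (snd z) / q (snd z)) \<partial>J)
      = (\<integral>\<^sup>+ y. (\<integral>\<^sup>+ x. ennreal (f x y) \<partial>P) * ennreal (h y / q y) \<partial>B)"
    by (subst nn_integral_J_swap, measurable)
       (auto intro!: nn_integral_cong simp: nn_integral_multc[symmetric])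
  also have "\<dots> \<le> (\<integral>\<^sup>+ y. ennreal (h y) \<partial>B)"
  proof (rule nn_integral_mono_AE, use AE_q in eventually_elim)
    case (elim y)
    have "ennreal (q y) * ennreal (h y / q y) \<le> ennreal (h y)"
      using assms(2)[of y] q_nonneg[of y]
      by (cases "q y = 0") (auto simp: ennreal_mult[symmetric])
    then show ?case by (simp add: elim)
  qed
  finally show ?thesis .
qed

lemma nn_integral_ratio_f: "(\<integral>\<^sup>+ z. ennreal (q (snd z) / f (fst z) (snd z)) \<partial>J) \<le> 1"
proof -
  have le: "ennreal (f x y) * ennreal (q y / f x y) \<le> ennreal (q y)"
    if "x \<in> space P" "y \<in> space B" for x y
    using nonneg[OF that] q_nonneg[of y]
    by (cases "f x y = 0") (auto simp: ennreal_mult[symmetric])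
  have "(\<integral>\<^sup>+ z. ennreal (q (snd z) / f (fst z) (snd z)) \<partial>J)
      \<le> (\<integral>\<^sup>+ x. \<integral>\<^sup>+ y. ennreal (q y) \<partial>B \<partial>P)"
    unfolding split_def
    by (subst nn_integral_J, measurable, unfold fst_conv snd_conv, intro nn_integral_mono le)
  also have "\<dots> = 1" by (simp add: nn_integral_q emeasure_space_1)
  finally show ?thesis .
qed

text \<open>\<open>- i\<close> is \<open>ln (q / f)\<close>, and \<open>ln u \<le> u\<close>; under
  \<open>J\<close> the factor \<open>f\<close> cancels and leaves at most the total mass of
  \<open>q\<close>. The bound 1 holds for every channel, so it is uniform over states and block
  lengths.\<close>

lemma nn_integral_neg_info: "(\<integral>\<^sup>+ z. ennreal (- i (fst z) (snd z)) \<partial>J) \<le> 1"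
proof -
  have "(\<integral>\<^sup>+ z. ennreal (- i (fst z) (snd z)) \<partial>J)
      \<le> (\<integral>\<^sup>+ z. ennreal (q (snd z) / f (fst z) (snd z)) \<partial>J)"
  proof (rule nn_integral_mono_AE, use AE_pos in eventually_elim)
    case (elim z)
    then have "- i (fst z) (snd z) = ln (q (snd z) / f (fst z) (snd z))"
      by (simp add: info_density_def ln_div)
    also have "\<dots> \<le> q (snd z) / f (fst z) (snd z)"
      using elim by (intro order.trans[OF ln_le_minus_one]) auto
    finally show ?case by (rule ennreal_leI)
  qed
  then show ?thesis using nn_integral_ratio_f by (rule order.trans)
qed

lemma integrable_neg_info: "integrable J (\<lambda>z. max 0 (- i (fst z) (snd z)))"
  and integral_neg_info: "(\<integral>z. max 0 (- i (fst z) (snd z)) \<partial>J) \<le> 1"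
proof -
  have eq: "(\<integral>\<^sup>+ z. ennreal (max 0 (- i (fst z) (snd z))) \<partial>J) = (\<integral>\<^sup>+ z. ennreal (- i (fst z) (snd z)) \<partial>J)"
    by (intro nn_integral_cong) (auto simp: max_def ennreal_neg)
  have [measurable]: "(\<lambda>z. i (fst z) (snd z)) \<in> borel_measurable (P \<Otimes>\<^sub>M B)"
    using measurable_i by (simp add: case_prod_beta')
  show I: "integrable J (\<lambda>z. max 0 (- i (fst z) (snd z)))"
    by (rule integrableI_nonneg)
       (use nn_integral_neg_info in \<open>auto simp: eq intro: le_less_trans\<close>)
  have "ennreal (\<integral>z. max 0 (- i (fst z) (snd z)) \<partial>J) \<le> 1"
    using nn_integral_eq_integral[OF I] nn_integral_neg_info by (simp add: eq)
  then show "(\<integral>z. max 0 (- i (fst z) (snd z)) \<partial>J) \<le> 1" by simp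
qed

end

section \<open>Memoryless block channels\<close>

lemma nn_integral_PiM_prod:
  assumes "finite I" "\<And>i. i \<in> I \<Longrightarrow> sigma_finite_measure (M i)"
    and "\<And>i. i \<in> I \<Longrightarrow> f i \<in> borel_measurable (M i)"
  shows "(\<integral>\<^sup>+ x. (\<Prod>i\<in>I. f i (x i)) \<partial>Pi\<^sub>M I M) = (\<Prod>i\<in>I. \<integral>\<^sup>+ x. f i x \<partial>M i)"
proof -
  \<comment> \<open>\<open>product_sigma_finite\<close> demands sigma-finiteness at every index,
    also outside \<open>I\<close>.\<close>
  define M' where "M' i = (if i \<in> I then M i else count_space {})" for i
  interpret product_sigma_finite M'
    by (rule product_sigma_finite.intro)
       (use assms(2) sigma_finite_measure_count_space_finite[of "{}"] in \<open>auto simp: M'_def\<close>)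
  have "Pi\<^sub>M I M = Pi\<^sub>M I M'"
    by (rule PiM_cong) (auto simp: M'_def)
  moreover have "(\<Prod>i\<in>I. \<integral>\<^sup>+ x. f i x \<partial>M' i) = (\<Prod>i\<in>I. \<integral>\<^sup>+ x. f i x \<partial>M i)"
    by (intro prod.cong) (auto simp: M'_def)
  ultimately show ?thesis
    using product_nn_integral_prod[of I f] assms by (simp add: M'_def)
qed

lemma sigma_finite_block:
  assumes "sigma_finite_measure B"
  shows "sigma_finite_measure (block B n)"
proof -
  interpret product_sigma_finite "\<lambda>_. B" by (rule product_sigma_finite.intro) (rule assms)
  show ?thesis unfolding block_def by (rule sigma_finite) simp
qed

lemma measurable_block_component:
  "k < n \<Longrightarrow> (\<lambda>x. x k) \<in> measurable (block M n) M"
  unfolding block_def by measurable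

lemma space_block_component: "k < n \<Longrightarrow> x \<in> space (block M n) \<Longrightarrow> x k \<in> space M"
  using measurable_space[OF measurable_block_component] .

lemma enn2real_prod: "enn2real (\<Prod>a\<in>I. h a) = (\<Prod>a\<in>I. enn2real (h a))"
  by (induction I rule: infinite_finite_induct) (auto simp: enn2real_mult)

locale memoryless_law =
  fixes A :: "'a measure" and B :: "'b measure" and n :: nat
    and P :: "(nat \<Rightarrow> 'a) measure" and f :: "(nat \<Rightarrow> 'a) \<Rightarrow> (nat \<Rightarrow> 'b) \<Rightarrow> real"
    and w :: "nat \<Rightarrow> 'a \<Rightarrow> 'b \<Rightarrow> real"
  assumes input: "P \<in> space (prob_algebra (block A n))"
    and sigma_finite_B: "sigma_finite_measure B"
    and block_density: "transition_density (block A n) (block B n) f"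
    and symbol_density: "\<And>k. k < n \<Longrightarrow> transition_density A B (w k)"
    and product_form: "\<And>x y. x \<in> space (block A n) \<Longrightarrow> y \<in> space (block B n) \<Longrightarrow>
      f x y = (\<Prod>k<n. w k (x k) (y k))"
begin

lemma sets_P: "sets P = sets (block A n)"
  using input by (simp add: space_prob_algebra)

lemma space_P: "space P = space (block A n)"
  using sets_P by (rule sets_eq_imp_space_eq)

sublocale channel_law P "block B n" f
proof (intro channel_law.intro channel_law_axioms.intro)
  show "prob_space P" using input by (simp add: space_prob_algebra)
  show "sigma_finite_measure (block B n)" by (rule sigma_finite_block[OF sigma_finite_B])
  show "transition_density P (block B n) f"
    using sets_P block_density by (rule transition_density_cong_sets)
qed

abbreviation "marg \<equiv> symbol_marginal A P"
abbreviation "symbol_law k \<equiv> joint_law (marg k) B (w k)"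
abbreviation "symbol_output k \<equiv> output_density (marg k) (w k)"
abbreviation "symbol_info k \<equiv> info_density (marg k) (w k)"

text \<open>For a product input this is the information density of the block
  (\<open>AE_info_eq\<close>). It depends on \<open>P\<close> through the marginals only.\<close>

definition sum_info :: "(nat \<Rightarrow> 'a) \<times> (nat \<Rightarrow> 'b) \<Rightarrow> real" where
  "sum_info z = (\<Sum>k<n. symbol_info k (fst z k) (snd z k))"

lemma sets_P_PiM [measurable_cong]: "sets P = sets (Pi\<^sub>M {..<n} (\<lambda>_. A))"
  using sets_P by (simp add: block_def)

lemma sets_J_PiM [measurable_cong]:
  "sets J = sets (Pi\<^sub>M {..<n} (\<lambda>_. A) \<Otimes>\<^sub>M Pi\<^sub>M {..<n} (\<lambda>_. B))"
  by (rule trans[OF sets_J sets_pair_measure_cong[OF sets_P_PiM]]) (simp add: block_def)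

lemma measurable_component_P: "k < n \<Longrightarrow> (\<lambda>x. x k) \<in> measurable P A"
  by measurable

lemma ennreal_product_form:
  assumes x: "x \<in> space (block A n)" and y: "y \<in> space (block B n)"
  shows "ennreal (f x y) = (\<Prod>k<n. ennreal (w k (x k) (y k)))"
proof -
  have "0 \<le> w k (x k) (y k)" if "k < n" for k
    using symbol_density[OF that] space_block_component[OF that x] space_block_component[OF that y]
    by (rule transition_densityD(2))
  then show ?thesis
    unfolding product_form[OF x y] by (subst prod_ennreal) auto
qed

section \<open>Symbol laws as marginals of the block law\<close>

lemma sets_marg [simp, measurable_cong]: "sets (marg k) = sets A"
  by (simp add: symbol_marginal_def)

lemma sets_marg_pair: "sets (marg k \<Otimes>\<^sub>M B) = sets (A \<Otimes>\<^sub>M B)"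
  by (rule sets_pair_measure_cong) simp_all

lemma measurable_marg_pair: "measurable (marg k \<Otimes>\<^sub>M B) N = measurable (A \<Otimes>\<^sub>M B) N"
  by (rule measurable_cong_sets[OF sets_marg_pair refl])

lemma symbol_channel_law: "k < n \<Longrightarrow> channel_law (marg k) B (w k)"
proof (intro channel_law.intro channel_law_axioms.intro)
  assume k: "k < n"
  show "prob_space (marg k)"
    unfolding symbol_marginal_def
    by (rule prob_space_distr) (rule measurable_component_P[OF k])
  show "sigma_finite_measure B" by (rule sigma_finite_B)
  show "transition_density (marg k) B (w k)"
    by (rule transition_density_cong_sets[OF _ symbol_density[OF k]])
       (simp add: symbol_marginal_def)
qed

lemma measurable_component_J [measurable]:
  "k < n \<Longrightarrow> (\<lambda>z. (fst z k, snd z k)) \<in> measurable J (A \<Otimes>\<^sub>M B)"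
  by measurable

text \<open>Given the input block, the outputs other than the \<open>k\<close>-th integrate out to
  1. The inputs may be dependent: the remaining coordinates enter only through the integral over
  \<open>P\<close>, which then collapses to the marginal.\<close>

lemma distr_J_component:
  assumes k: "k < n"
  shows "distr J (A \<Otimes>\<^sub>M B) (\<lambda>z. (fst z k, snd z k)) = symbol_law k"
proof (rule measure_eqI)
  interpret K: channel_law "marg k" B "w k" by (rule symbol_channel_law[OF k])
  show "sets (distr J (A \<Otimes>\<^sub>M B) (\<lambda>z. (fst z k, snd z k))) = sets (symbol_law k)"
    by (simp add: sets_marg_pair)
  fix E assume "E \<in> sets (distr J (A \<Otimes>\<^sub>M B) (\<lambda>z. (fst z k, snd z k)))"
  then have E: "E \<in> sets (A \<Otimes>\<^sub>M B)" by simp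
  note [measurable] = E k
  have wm: "(\<lambda>y. ennreal (w j x y)) \<in> borel_measurable B" if "j < n" "x \<in> space A" for j x
    using measurable_compose[OF measurable_Pair1'[OF that(2)] transition_densityD(1)[OF symbol_density[OF that(1)]]]
    by simp
  have "emeasure (distr J (A \<Otimes>\<^sub>M B) (\<lambda>z. (fst z k, snd z k))) E
      = (\<integral>\<^sup>+ z. indicator E z \<partial>distr J (A \<Otimes>\<^sub>M B) (\<lambda>z. (fst z k, snd z k)))"
    by simp
  also have "\<dots> = (\<integral>\<^sup>+ z. indicator E (fst z k, snd z k) \<partial>J)"
    by (rule nn_integral_distr[OF measurable_component_J[OF k]]) simp
  also have "\<dots> = (\<integral>\<^sup>+ x. \<integral>\<^sup>+ y. ennreal (f x y) * indicator E (x k, y k) \<partial>block B n \<partial>P)"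
  proof (subst nn_integral_J)
    show "(\<lambda>z. indicator E (fst z k, snd z k)) \<in> borel_measurable (P \<Otimes>\<^sub>M block B n)"
      using measurable_compose[OF measurable_component_J[OF k] borel_measurable_indicator[OF E]]
      by (simp add: measurable_cong_sets[OF sets_J refl])
  qed simp
  also have "\<dots> = (\<integral>\<^sup>+ x. \<integral>\<^sup>+ y. ennreal (w k (x k) y) * indicator E (x k, y) \<partial>B \<partial>P)"
  proof (intro nn_integral_cong)
    fix x assume "x \<in> space P"
    then have x: "x \<in> space (block A n)" by (simp add: space_P)
    \<comment> \<open>The test function is placed in the \<open>k\<close>-th factor, so that the
      integrand is a product over coordinates.\<close>
    define g where "g j y = ennreal (w j (x j) y) * (if j = k then indicator E (x k, y) else 1)" for j y
    have xk: "x j \<in> space A" if "j < n" for j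
      using space_block_component[OF that x] .
    have "(\<integral>\<^sup>+ y. ennreal (f x y) * indicator E (x k, y k) \<partial>block B n)
        = (\<integral>\<^sup>+ y. (\<Prod>j<n. g j (y j)) \<partial>Pi\<^sub>M {..<n} (\<lambda>_. B))"
      unfolding block_def[of B]
    proof (intro nn_integral_cong)
      fix y assume y: "y \<in> space (Pi\<^sub>M {..<n} (\<lambda>_. B))"
      have "(\<Prod>j<n. g j (y j)) = (\<Prod>j<n. ennreal (w j (x j) (y j))) * (\<Prod>j<n. if j = k then indicator E (x k, y k) else 1)"
        unfolding prod.distrib[symmetric] by (rule prod.cong) (auto simp: g_def)
      also have "(\<Prod>j<n. if j = k then indicator E (x k, y k) else (1::ennreal)) = indicator E (x k, y k)"
        using k by (subst prod.delta) auto
      also have "(\<Prod>j<n. ennreal (w j (x j) (y j))) = ennreal (f x y)"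
        using x y by (simp add: ennreal_product_form block_def)
      finally show "ennreal (f x y) * indicator E (x k, y k) = (\<Prod>j<n. g j (y j))" ..
    qed
    also have "\<dots> = (\<Prod>j<n. \<integral>\<^sup>+ y. g j y \<partial>B)"
    proof (intro nn_integral_PiM_prod sigma_finite_B)
      fix j assume j: "j \<in> {..<n}"
      have "(\<lambda>y. indicator E (x k, y) :: ennreal) \<in> borel_measurable B"
        using measurable_compose[OF measurable_Pair1'[OF xk[OF k]] borel_measurable_indicator[OF E]] .
      then have "(\<lambda>y. if j = k then indicator E (x k, y) else 1 :: ennreal) \<in> borel_measurable B"
        by (cases "j = k") simp_all
      then show "g j \<in> borel_measurable B"
        unfolding g_def using wm[of j "x j"] xk j by (intro borel_measurable_times_ennreal) auto
    qed simp
    also have "\<dots> = (\<Prod>j<n. if j = k then \<integral>\<^sup>+ y. g k y \<partial>B else 1)"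
      using xk by (intro prod.cong) (auto simp: g_def transition_densityD(3)[OF symbol_density])
    also have "\<dots> = (\<integral>\<^sup>+ y. g k y \<partial>B)"
      using k by (subst prod.delta) auto
    finally show "(\<integral>\<^sup>+ y. ennreal (f x y) * indicator E (x k, y k) \<partial>block B n)
        = (\<integral>\<^sup>+ y. ennreal (w k (x k) y) * indicator E (x k, y) \<partial>B)"
      by (simp add: g_def)
  qed
  also have "\<dots> = (\<integral>\<^sup>+ x. \<integral>\<^sup>+ y. ennreal (w k x y) * indicator E (x, y) \<partial>B \<partial>marg k)"
  proof -
    have [measurable]: "(\<lambda>(x, y). w k x y) \<in> borel_measurable (A \<Otimes>\<^sub>M B)"
      by (rule transition_densityD(1)[OF symbol_density[OF k]])
    interpret B: sigma_finite_measure B by (rule sigma_finite_B)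
    have "(\<lambda>x. \<integral>\<^sup>+ y. ennreal (w k x y) * indicator E (x, y) \<partial>B) \<in> borel_measurable A"
      by measurable
    then show ?thesis
      unfolding symbol_marginal_def by (subst nn_integral_distr[OF measurable_component_P[OF k]]) auto
  qed
  also have "\<dots> = (\<integral>\<^sup>+ z. indicator E z \<partial>symbol_law k)"
    using E by (subst K.nn_integral_J) (auto simp: sets_marg_pair measurable_marg_pair)
  also have "\<dots> = emeasure (symbol_law k) E"
    using E by (subst nn_integral_indicator) (auto simp: sets_marg_pair measurable_marg_pair)
  finally show "emeasure (distr J (A \<Otimes>\<^sub>M B) (\<lambda>z. (fst z k, snd z k))) E = emeasure (symbol_law k) E" .
qed

lemma measurable_symbol_info:
  assumes "k < n"
  shows "(\<lambda>z. symbol_info k (fst z) (snd z)) \<in> borel_measurable (A \<Otimes>\<^sub>M B)"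
proof -
  interpret K: channel_law "marg k" B "w k" by (rule symbol_channel_law[OF assms])
  show ?thesis using K.measurable_i
    by (simp add: case_prod_beta' measurable_marg_pair)
qed

lemma measurable_symbol_output [measurable]:
  assumes "k < n"
  shows "symbol_output k \<in> borel_measurable B"
proof -
  interpret K: channel_law "marg k" B "w k" by (rule symbol_channel_law[OF assms])
  show ?thesis by (rule K.measurable_q)
qed

lemma measurable_symbol_info_J [measurable]:
  "k < n \<Longrightarrow> (\<lambda>z. symbol_info k (fst z k) (snd z k)) \<in> borel_measurable J"
  using measurable_compose[OF measurable_component_J measurable_symbol_info, of k] by simp

lemma measurable_sum_info [measurable]: "sum_info \<in> borel_measurable J"
  unfolding sum_info_def[abs_def] by (rule borel_measurable_sum) (rule measurable_symbol_info_J, simp)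

lemma measurable_info_J [measurable]: "(\<lambda>z. i (fst z) (snd z)) \<in> borel_measurable J"
  using measurable_i by (simp add: case_prod_beta' measurable_cong_sets[OF sets_J refl])

lemma AE_symbol_pos:
  assumes "k < n"
  shows "AE z in J. 0 < w k (fst z k) (snd z k) \<and> 0 < symbol_output k (snd z k)"
proof -
  interpret K: channel_law "marg k" B "w k" by (rule symbol_channel_law[OF assms])
  show ?thesis
    using AE_distrD[OF measurable_component_J[OF assms]
        K.AE_pos[unfolded distr_J_component[OF assms, symmetric]]] by simp
qed

lemma AE_symbols_pos:
  "AE z in J. \<forall>k<n. 0 < w k (fst z k) (snd z k) \<and> 0 < symbol_output k (snd z k)"
  using AE_symbol_pos by (subst AE_all_countable) (auto intro!: AE_impI)

lemma integrable_symbol_info_iff: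
  "k < n \<Longrightarrow> integrable J (\<lambda>z. symbol_info k (fst z k) (snd z k)) \<longleftrightarrow>
    integrable (symbol_law k) (\<lambda>z. symbol_info k (fst z) (snd z))"
  using integrable_distr_eq[OF measurable_component_J measurable_symbol_info, of k k]
  by (simp add: distr_J_component)

lemma integral_symbol_info:
  "k < n \<Longrightarrow> (\<integral>z. symbol_info k (fst z k) (snd z k) \<partial>J) = (\<integral>z. symbol_info k (fst z) (snd z) \<partial>symbol_law k)"
  using integral_distr[OF measurable_component_J measurable_symbol_info, of k k]
  by (simp add: distr_J_component)

lemma integrable_neg_symbol_info:
  assumes "k < n"
  shows "integrable J (\<lambda>z. max 0 (- symbol_info k (fst z k) (snd z k)))"
proof -
  interpret K: channel_law "marg k" B "w k" by (rule symbol_channel_law[OF assms])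
  have "(\<lambda>z. max 0 (- symbol_info k (fst z) (snd z))) \<in> borel_measurable (A \<Otimes>\<^sub>M B)"
    using measurable_symbol_info[OF assms] by measurable
  from integrable_distr_eq[OF measurable_component_J[OF assms] this] K.integrable_neg_info
  show ?thesis by (simp add: distr_J_component[OF assms])
qed

text \<open>Integrability of a sum says little about its terms in general. Here the negative parts
  are integrable anyway; adding them leaves a sum of positive parts, which dominates each single
  one.\<close>

lemma integrable_symbol_info:
  assumes "integrable J sum_info" and k: "k < n"
  shows "integrable (symbol_law k) (\<lambda>z. symbol_info k (fst z) (snd z))"
proof -
  let ?neg = "\<lambda>j z. max 0 (- symbol_info j (fst z j) (snd z j))"
  let ?h = "\<lambda>z. sum_info z + (\<Sum>j<n. ?neg j z)"
  have "integrable J ?h"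
    using assms by (intro Bochner_Integration.integrable_add Bochner_Integration.integrable_sum integrable_neg_symbol_info) auto
  \<comment> \<open>\<open>?h\<close> dominates only the positive part of the \<open>k\<close>-th
    term; the extra negative part is for its absolute value.\<close>
  then have "integrable J (\<lambda>z. ?h z + ?neg k z)"
    by (rule Bochner_Integration.integrable_add) (rule integrable_neg_symbol_info[OF k])
  then have "integrable J (\<lambda>z. symbol_info k (fst z k) (snd z k))"
  proof (rule Bochner_Integration.integrable_bound)
    show "AE z in J. norm (symbol_info k (fst z k) (snd z k)) \<le> norm (?h z + ?neg k z)"
    proof (rule AE_I2)
      fix z
      have "symbol_info k (fst z k) (snd z k) + ?neg k z
          \<le> (\<Sum>j<n. symbol_info j (fst z j) (snd z j) + ?neg j z)"
        using k by (intro member_le_sum[of k "{..<n}" "\<lambda>j. symbol_info j (fst z j) (snd z j) + ?neg j z"]) auto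
      also have "\<dots> = ?h z" by (simp add: sum_info_def sum.distrib)
      finally show "norm (symbol_info k (fst z k) (snd z k)) \<le> norm (?h z + ?neg k z)"
        by (simp add: max_def split: if_splits)
    qed
  qed (rule measurable_symbol_info_J[OF k])
  then show ?thesis using k by (simp add: integrable_symbol_info_iff)
qed

lemma integrable_sum_info:
  assumes "\<And>k. k < n \<Longrightarrow> integrable (symbol_law k) (\<lambda>z. symbol_info k (fst z) (snd z))"
  shows "integrable J sum_info"
  unfolding sum_info_def[abs_def]
  by (rule Bochner_Integration.integrable_sum) (use assms in \<open>auto simp: integrable_symbol_info_iff\<close>)

lemma integral_sum_info:
  assumes "\<And>k. k < n \<Longrightarrow> integrable (symbol_law k) (\<lambda>z. symbol_info k (fst z) (snd z))"
  shows "(\<integral>z. sum_info z \<partial>J) = (\<Sum>k<n. \<integral>z. symbol_info k (fst z) (snd z) \<partial>symbol_law k)"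
  unfolding sum_info_def
  by (subst Bochner_Integration.integral_sum)
     (use assms in \<open>auto simp: integrable_symbol_info_iff integral_symbol_info\<close>)

section \<open>Block information density against the sum over symbols\<close>

definition output_ratio :: "(nat \<Rightarrow> 'a) \<times> (nat \<Rightarrow> 'b) \<Rightarrow> real" where
  "output_ratio z = (\<Prod>k<n. symbol_output k (snd z k)) / q (snd z)"

lemma symbol_output_nonneg: "0 \<le> symbol_output k y"
  unfolding output_density_def by simp

lemma output_ratio_nonneg: "0 \<le> output_ratio z"
  unfolding output_ratio_def by (intro divide_nonneg_nonneg prod_nonneg q_nonneg ballI symbol_output_nonneg)

lemma measurable_prod_output [measurable]:
  "(\<lambda>y. \<Prod>k<n. symbol_output k (y k)) \<in> borel_measurable (block B n)"
  by (rule borel_measurable_prod)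
     (use measurable_compose[OF measurable_block_component measurable_symbol_output] in auto)

lemma measurable_output_ratio [measurable]: "output_ratio \<in> borel_measurable J"
proof -
  have snd: "snd \<in> measurable J (block B n)"
    by (simp add: measurable_cong_sets[OF sets_J refl])
  show ?thesis
    unfolding output_ratio_def[abs_def]
    by (rule borel_measurable_divide[OF measurable_compose[OF snd measurable_prod_output]
          measurable_compose[OF snd measurable_q]])
qed

text \<open>The change of measure in \<open>nn_integral_ratio_q\<close> leaves the total mass of a
  product of probability densities.\<close>

lemma nn_integral_output_ratio: "(\<integral>\<^sup>+ z. ennreal (output_ratio z) \<partial>J) \<le> 1"
proof -
  have "(\<integral>\<^sup>+ z. ennreal (output_ratio z) \<partial>J)
      \<le> (\<integral>\<^sup>+ y. ennreal (\<Prod>k<n. symbol_output k (y k)) \<partial>block B n)"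
    unfolding output_ratio_def
    by (rule nn_integral_ratio_q) (auto intro!: prod_nonneg symbol_output_nonneg)
  also have "\<dots> = (\<integral>\<^sup>+ y. (\<Prod>k<n. ennreal (symbol_output k (y k))) \<partial>block B n)"
    by (simp add: prod_ennreal symbol_output_nonneg)
  also have "\<dots> = (\<Prod>k<n. \<integral>\<^sup>+ y. ennreal (symbol_output k y) \<partial>B)"
    unfolding block_def by (intro nn_integral_PiM_prod sigma_finite_B) auto
  also have "\<dots> = 1"
    using symbol_channel_law by (intro prod.neutral ballI) (auto intro: channel_law.nn_integral_q)
  finally show ?thesis .
qed

lemma integrable_output_ratio: "integrable J output_ratio"
  and integral_output_ratio: "(\<integral>z. output_ratio z \<partial>J) \<le> 1"
proof -
  show I: "integrable J output_ratio"
    by (rule integrableI_nonneg)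
       (use nn_integral_output_ratio in \<open>auto simp: output_ratio_nonneg intro: le_less_trans\<close>)
  have "ennreal (\<integral>z. output_ratio z \<partial>J) \<le> 1"
    using nn_integral_eq_integral[OF I] nn_integral_output_ratio by (simp add: output_ratio_nonneg)
  then show "(\<integral>z. output_ratio z \<partial>J) \<le> 1" by simp
qed

text \<open>The transition density of the block is the product of the symbol ones, so it cancels in
  the difference and only output densities remain. The pointwise inequality stands in for
  subadditivity of the output entropy, which need not be finite here.\<close>

lemma AE_info_le: "AE z in J. i (fst z) (snd z) \<le> sum_info z + output_ratio z - 1"
  using AE_pos AE_symbols_pos AE_space
proof eventually_elim
  case (elim z)
  have ln_ratio: "ln (a / c) - ln (a / b) = ln (b / c)" if "0 < a" "0 < b" "0 < c" for a b c :: real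
    using that by (simp add: ln_div)
  let ?w = "\<Prod>k<n. w k (fst z k) (snd z k)" and ?o = "\<Prod>k<n. symbol_output k (snd z k)"
  have f: "f (fst z) (snd z) = ?w"
    using elim(3) by (intro product_form) (auto simp: space_J space_P)
  have pos: "0 < ?w" "0 < ?o" using elim by (auto intro!: prod_pos)
  have "sum_info z = ln (\<Prod>k<n. w k (fst z k) (snd z k) / symbol_output k (snd z k))"
    unfolding sum_info_def info_density_def using elim by (subst ln_prod) auto
  also have "\<dots> = ln (?w / ?o)" by (simp add: prod_dividef)
  finally have "i (fst z) (snd z) - sum_info z = ln (?o / q (snd z))"
    using ln_ratio[OF pos] elim(1) by (simp only: info_density_def f)
  also have "\<dots> \<le> ?o / q (snd z) - 1"
    using elim pos by (intro ln_le_minus_one) auto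
  finally show ?case by (simp add: output_ratio_def)
qed

text \<open>On the event, \<open>n * R\<close> is at most \<open>i\<close>; elsewhere
  \<open>i\<close> plus its negative part is nonnegative. Expectations are taken only after
  \<open>i\<close> has been replaced by \<open>sum_info\<close> and \<open>output_ratio\<close>. The
  final 1 is made of 1 for the ratio, minus 1, plus 1 for the negative part.\<close>

lemma rate_bound:
  assumes int: "\<And>k. k < n \<Longrightarrow> integrable (symbol_law k) (\<lambda>z. symbol_info k (fst z) (snd z))"
    and R: "0 \<le> R"
  shows "real n * R * measure J {z \<in> space J. R < i (fst z) (snd z) / real n}
    \<le> (\<Sum>k<n. \<integral>z. symbol_info k (fst z) (snd z) \<partial>symbol_law k) + 1"
proof -
  interpret J: prob_space J by (rule prob_space_J)
  let ?E = "{z \<in> space J. R < i (fst z) (snd z) / real n}"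
  let ?neg = "\<lambda>z. max 0 (- i (fst z) (snd z))"
  have E: "?E \<in> sets J" by measurable
  have "real n * R * measure J ?E = (\<integral>z. real n * R * indicator ?E z \<partial>J)"
    using E by simp
  also have "\<dots> \<le> (\<integral>z. sum_info z + output_ratio z - 1 + ?neg z \<partial>J)"
  proof (rule integral_mono_AE)
    show "integrable J (\<lambda>z. real n * R * indicator ?E z)"
      using E by (intro integrable_mult_right) (auto simp: J.emeasure_eq_measure)
    show "integrable J (\<lambda>z. sum_info z + output_ratio z - 1 + ?neg z)"
      using integrable_sum_info[OF int] integrable_output_ratio integrable_neg_info by auto
    show "AE z in J. real n * R * indicator ?E z \<le> sum_info z + output_ratio z - 1 + ?neg z"
      using AE_info_le
    proof eventually_elim
      case (elim z)
      have "real n * R * indicator ?E z \<le> i (fst z) (snd z) + ?neg z"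
      proof (cases "z \<in> ?E")
        case True
        \<comment> \<open>At \<open>n = 0\<close> the quotient is 0 by convention, so
          \<open>0 \<le> R\<close> makes the event empty.\<close>
        then have "0 < real n"
          using R by (cases "n = 0") auto
        then have "real n * R \<le> i (fst z) (snd z)"
          using True by (auto simp: field_simps)
        then show ?thesis using True by auto
      qed auto
      with elim show ?case by linarith
    qed
  qed
  also have "\<dots> = (\<integral>z. sum_info z \<partial>J) + (\<integral>z. output_ratio z \<partial>J) - 1 + (\<integral>z. ?neg z \<partial>J)"
    using integrable_sum_info[OF int] integrable_output_ratio integrable_neg_info
    by (simp add: J.prob_space)
  finally show ?thesis
    using integral_output_ratio integral_neg_info by (simp add: integral_sum_info[OF int])
qed

section \<open>Variance and concentration of the sum\<close>

lemma integrable_sum_info_if_variance: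
  assumes "ext_variance J (\<lambda>z. sum_info z / real n) < \<infinity>"
  shows "integrable J sum_info"
proof -
  interpret J: prob_space J by (rule prob_space_J)
  \<comment> \<open>Were the rate not integrable, \<open>c\<close> would be the default 0; a finite
    second moment around any constant gives integrability.\<close>
  define c where "c = (\<integral>z. sum_info z / real n \<partial>J)"
  have "integrable J (\<lambda>z. (sum_info z / real n - c)\<^sup>2)"
  proof (rule integrableI_nonneg)
    show "(\<integral>\<^sup>+ z. ennreal ((sum_info z / real n - c)\<^sup>2) \<partial>J) < \<infinity>"
      using assms by (simp add: ext_variance_def c_def)
  qed simp_all
  then have "integrable J (\<lambda>z. sum_info z / real n - c)"
    by (rule J.square_integrable_imp_integrable[rotated]) measurable
  then have "integrable J (\<lambda>z. (sum_info z / real n - c) + c)"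
    by (rule Bochner_Integration.integrable_add) simp
  then have "integrable J (\<lambda>z. real n * (sum_info z / real n))"
    by (intro integrable_mult_right) simp
  moreover have "real n * (sum_info z / real n) = sum_info z" for z
    unfolding sum_info_def by (cases "n = 0") simp_all
  ultimately show ?thesis by simp
qed

text \<open>Chebyshev's inequality in \<open>ennreal\<close>, so that an infinite variance is no
  separate case.\<close>

lemma chebyshev_sum_info:
  assumes "0 < g" and mu: "mu + g \<le> (\<integral>z. sum_info z / real n \<partial>J)"
  shows "emeasure J {z \<in> space J. sum_info z / real n \<le> mu}
    \<le> ext_variance J (\<lambda>z. sum_info z / real n) / ennreal (g\<^sup>2)"
proof -
  define c where "c = (\<integral>z. sum_info z / real n \<partial>J)"
  let ?E = "{z \<in> space J. sum_info z / real n \<le> mu}"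
  have E: "?E \<in> sets J" by measurable
  have "ennreal (g\<^sup>2) * emeasure J ?E = (\<integral>\<^sup>+ z. ennreal (g\<^sup>2) * indicator ?E z \<partial>J)"
    using E by (simp add: nn_integral_cmult)
  also have "\<dots> \<le> (\<integral>\<^sup>+ z. ennreal ((sum_info z / real n - c)\<^sup>2) \<partial>J)"
  proof (intro nn_integral_mono)
    fix z
    show "ennreal (g\<^sup>2) * indicator ?E z \<le> ennreal ((sum_info z / real n - c)\<^sup>2)"
    proof (cases "z \<in> ?E")
      case True
      then have "g \<le> \<bar>sum_info z / real n - c\<bar>" using mu by (auto simp: c_def)
      then have "g\<^sup>2 \<le> (sum_info z / real n - c)\<^sup>2"
        using \<open>0 < g\<close> abs_le_square_iff[of g "sum_info z / real n - c"] by simp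
      then show ?thesis using True by (auto intro: ennreal_leI)
    qed auto
  qed
  finally have "ennreal (g\<^sup>2) * emeasure J ?E \<le> ext_variance J (\<lambda>z. sum_info z / real n)"
    by (simp add: ext_variance_def c_def)
  then have "emeasure J ?E * ennreal (g\<^sup>2) / ennreal (g\<^sup>2)
      \<le> ext_variance J (\<lambda>z. sum_info z / real n) / ennreal (g\<^sup>2)"
    by (intro divide_right_mono_ennreal) (simp add: mult.commute)
  also have "emeasure J ?E * ennreal (g\<^sup>2) / ennreal (g\<^sup>2) = emeasure J ?E"
    using \<open>0 < g\<close> by (intro ennreal_mult_divide_eq) auto
  finally show ?thesis .
qed

lemma mutual_info_eq:
  assumes k: "k < n" and int: "integrable (symbol_law k) (\<lambda>z. symbol_info k (fst z) (snd z))"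
  shows "mutual_info (marg k) B (w k) = ereal (\<integral>z. symbol_info k (fst z) (snd z) \<partial>symbol_law k)"
proof -
  let ?g = "\<lambda>z. symbol_info k (fst z) (snd z)"
  have fin: "(\<integral>\<^sup>+ z. ennreal (?g z) \<partial>symbol_law k) < \<infinity>" "(\<integral>\<^sup>+ z. ennreal (- ?g z) \<partial>symbol_law k) < \<infinity>"
    using real_integrable_def[THEN iffD1, OF int] by (auto simp: top.not_eq_extremum)
  have *: "enn2ereal x = ereal (enn2real x)" if "x < \<infinity>" for x
    using that by (cases x) (auto simp: enn2ereal_ennreal)
  show ?thesis
    unfolding mutual_info_def ext_expectation_def case_prod_beta' real_lebesgue_integral_def[OF int]
      *[OF fin(1)] *[OF fin(2)]
    by simp
qed

text \<open>Being the product of its own marginals is how independence of the input is expressed.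
  The output density then factorises like the transition density, and the logarithm splits.\<close>

lemma AE_info_eq:
  assumes P: "P = Pi\<^sub>M {..<n} marg"
  shows "AE z in J. i (fst z) (snd z) = sum_info z"
  using AE_pos AE_symbols_pos AE_space
proof eventually_elim
  case (elim z)
  obtain x y where z: "z = (x, y)" by (cases z)
  have x: "x \<in> space (block A n)" and y: "y \<in> space (block B n)"
    using elim(3) by (auto simp: space_J space_P z)
  have wm: "(\<lambda>x. ennreal (w k x (y k))) \<in> borel_measurable (marg k)" if "k < n" for k
    using measurable_compose[OF measurable_Pair2'[OF space_block_component[OF that y]]
        transition_densityD(1)[OF symbol_density[OF that]]]
    by (simp add: measurable_cong_sets[OF sets_marg refl])
  have "(\<integral>\<^sup>+ x. ennreal (f x y) \<partial>P) = (\<integral>\<^sup>+ x. (\<Prod>k<n. ennreal (w k (x k) (y k))) \<partial>P)"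
  proof (intro nn_integral_cong)
    fix x assume "x \<in> space P"
    then show "ennreal (f x y) = (\<Prod>k<n. ennreal (w k (x k) (y k)))"
      using y by (simp add: ennreal_product_form space_P)
  qed
  also have "\<dots> = (\<integral>\<^sup>+ x. (\<Prod>k<n. ennreal (w k (x k) (y k))) \<partial>Pi\<^sub>M {..<n} marg)"
    by (subst P) (rule refl)
  also have "\<dots> = (\<Prod>k<n. \<integral>\<^sup>+ x. ennreal (w k x (y k)) \<partial>marg k)"
    using symbol_channel_law[THEN channel_law.axioms(1)]
    by (intro nn_integral_PiM_prod) (auto intro!: wm prob_space_imp_sigma_finite)
  \<comment> \<open>\<open>enn2real\<close> is multiplicative also at infinity, so the factors need
    not be finite.\<close>
  finally have "q y = (\<Prod>k<n. symbol_output k (y k))"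
    unfolding output_density_def
    by (simp only: enn2real_prod)
  moreover have "f x y = (\<Prod>k<n. w k (x k) (y k))"
    using x y by (rule product_form)
  ultimately have "i x y = ln (\<Prod>k<n. w k (x k) (y k) / symbol_output k (y k))"
    by (simp add: info_density_def prod_dividef)
  also have "\<dots> = sum_info z"
    unfolding sum_info_def info_density_def using elim z by (subst ln_prod) auto
  finally show ?case by (simp add: z)
qed

end

section \<open>Optimality of independent inputs\<close>

lemma memoryless_inputs_subset: "memoryless_inputs A \<subseteq> inputs A"
proof
  fix X assume X: "X \<in> memoryless_inputs A"
  have "X n \<in> space (prob_algebra (block A n))" for n
  proof -
    obtain Q where Q: "Q \<in> symbol_dists A n" "X n = Pi\<^sub>M {..<n} Q"
      using X unfolding memoryless_inputs_def by blast
    then have "prob_space (X n)"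
      by (auto intro!: prob_space_PiM simp: symbol_dists_def space_prob_algebra)
    moreover have "sets (X n) = sets (block A n)"
      unfolding Q(2) block_def using Q(1)
      by (intro sets_PiM_cong) (auto simp: symbol_dists_def space_prob_algebra)
    ultimately show ?thesis by (simp add: space_prob_algebra)
  qed
  then show "X \<in> inputs A" by (simp add: inputs_def)
qed

lemma symbol_marginal_in_symbol_dists:
  assumes "X \<in> inputs A"
  shows "symbol_marginal A (X n) \<in> symbol_dists A n"
  unfolding symbol_dists_def
proof safe
  fix k assume "k < n"
  have X: "prob_space (X n)" "sets (X n) = sets (block A n)"
    using assms by (auto simp: inputs_def space_prob_algebra)
  have "(\<lambda>x. x k) \<in> measurable (X n) A"
    using measurable_block_component[OF \<open>k < n\<close>]
    by (simp add: measurable_cong_sets[OF X(2) refl])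
  then show "symbol_marginal A (X n) k \<in> space (prob_algebra A)"
    using X(1) by (simp add: symbol_marginal_def space_prob_algebra prob_space.prob_space_distr)
qed

lemma independent_version_memoryless:
  "X \<in> inputs A \<Longrightarrow> independent_version A X \<in> memoryless_inputs A"
  using symbol_marginal_in_symbol_dists unfolding memoryless_inputs_def independent_version_def by blast

lemma symbol_marginal_PiM:
  assumes Q: "Q \<in> symbol_dists A n" and k: "k < n"
  shows "symbol_marginal A (Pi\<^sub>M {..<n} Q) k = Q k"
proof -
  have Q': "prob_space (Q j)" "sets (Q j) = sets A" if "j < n" for j
    using Q that by (auto simp: symbol_dists_def space_prob_algebra)
  have "symbol_marginal A (Pi\<^sub>M {..<n} Q) k = distr (Pi\<^sub>M {..<n} Q) (Q k) (\<lambda>x. x k)"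
    unfolding symbol_marginal_def using Q'(2)[OF k] by (intro distr_cong) auto
  also have "\<dots> = Q k"
    using Q' k by (intro distr_PiM_component) auto
  finally show ?thesis .
qed

lemma symbol_marginal_independent_version:
  "X \<in> inputs A \<Longrightarrow> k < n \<Longrightarrow>
    symbol_marginal A (independent_version A X n) k = symbol_marginal A (X n) k"
  unfolding independent_version_def
  by (rule symbol_marginal_PiM[OF symbol_marginal_in_symbol_dists])

text \<open>Carries statements about independent versions over to all memoryless inputs.\<close>

lemma independent_version_idem:
  assumes "X \<in> memoryless_inputs A"
  shows "independent_version A X = X"
proof
  fix n
  obtain Q where Q: "Q \<in> symbol_dists A n" "X n = Pi\<^sub>M {..<n} Q"
    using assms unfolding memoryless_inputs_def by blast
  show "independent_version A X n = X n"
    unfolding independent_version_def Q(2)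
    by (rule PiM_cong) (auto simp: symbol_marginal_PiM[OF Q(1)])
qed

lemma symbol_dists_nonempty:
  assumes "space A \<noteq> {}"
  shows "symbol_dists A n \<noteq> {}"
proof -
  obtain a where "a \<in> space A" using assms by auto
  then have "(\<lambda>_. return A a) \<in> symbol_dists A n"
    by (auto simp: symbol_dists_def space_prob_algebra prob_space_return)
  then show ?thesis by blast
qed

locale compound_memoryless =
  fixes A :: "'a measure" and B :: "'b measure" and S :: "'s set"
    and p :: "('s, 'a, 'b) block_channel" and w :: "('s, 'a, 'b) symbol_channel"
  assumes compound: "compound_channel A B S p" and memoryless: "memoryless A B S p w"
begin

lemma memoryless_law:
  assumes "X \<in> inputs A" "s \<in> S"
  shows "memoryless_law A B n (X n) (p s n) (w s n)"
  using compound memoryless assms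
  by (intro memoryless_law.intro) (auto simp: compound_channel_def memoryless_def inputs_def)

definition info_tail :: "nat \<Rightarrow> (nat \<Rightarrow> 'a) measure \<Rightarrow> real \<Rightarrow> 's \<Rightarrow> ennreal" where
  "info_tail n P R s = (let J = joint_law P (block B n) (p s n) in
     emeasure J {z \<in> space J. info_density P (p s n) (fst z) (snd z) / real n \<le> R})"

text \<open>Bochner integrals default to 0, so this is the sum of the mutual informations only under
  \<open>integrable_infos\<close>. It is not divided by \<open>n\<close>, which keeps the
  inequalities below free of quotients.\<close>

definition mean_info :: "nat \<Rightarrow> (nat \<Rightarrow> 'a) measure \<Rightarrow> 's \<Rightarrow> real" where
  "mean_info n P s = (\<Sum>k<n. \<integral>z. info_density (symbol_marginal A P k) (w s n k) (fst z) (snd z)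
     \<partial>joint_law (symbol_marginal A P k) B (w s n k))"

definition integrable_infos :: "nat \<Rightarrow> (nat \<Rightarrow> 'a) measure \<Rightarrow> 's \<Rightarrow> bool" where
  "integrable_infos n P s \<longleftrightarrow> (\<forall>k<n. integrable (joint_law (symbol_marginal A P k) B (w s n k))
     (\<lambda>z. info_density (symbol_marginal A P k) (w s n k) (fst z) (snd z)))"

abbreviation "variance_vanishes X \<equiv> (\<lambda>n. SUP s\<in>S. info_rate_variance A B p w X s n) \<longlonglongrightarrow> 0"

abbreviation "info_rate_ge X R \<equiv> (\<lambda>n. SUP s\<in>S. info_tail n (X n) R s) \<longlonglongrightarrow> 0"

lemma inf_info_rate_eq: "inf_info_rate B S p X = Sup {ereal R | R. info_rate_ge X R}"
  unfolding inf_info_rate_def info_tail_def Let_def by (simp add: case_prod_beta')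

lemma mean_info_independent_version:
  assumes "X \<in> inputs A"
  shows "mean_info n (independent_version A X n) s = mean_info n (X n) s"
  unfolding mean_info_def
  by (rule sum.cong) (simp_all add: symbol_marginal_independent_version[OF assms])

lemma integrable_infos_independent_version:
  assumes "X \<in> inputs A"
  shows "integrable_infos n (independent_version A X n) s \<longleftrightarrow> integrable_infos n (X n) s"
  unfolding integrable_infos_def by (simp add: symbol_marginal_independent_version[OF assms])

lemma info_rate_variance_eq:
  assumes X: "X \<in> inputs A" and s: "s \<in> S"
  shows "info_rate_variance A B p w X s n =
    ext_variance (joint_law (independent_version A X n) (block B n) (p s n))
      (\<lambda>z. memoryless_law.sum_info A n (independent_version A X n) (w s n) z / real n)"
proof -
  interpret I: memoryless_law A B n "independent_version A X n" "p s n" "w s n"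
    using memoryless_inputs_subset independent_version_memoryless[OF X] s
    by (intro memoryless_law) auto
  have "I.sum_info z = (\<Sum>k<n. info_density (symbol_marginal A (X n) k) (w s n k) (fst z k) (snd z k))" for z
    unfolding I.sum_info_def
    by (rule sum.cong) (simp_all add: symbol_marginal_independent_version[OF X])
  then show ?thesis
    unfolding info_rate_variance_def by (simp add: case_prod_beta')
qed

text \<open>\<open>ext_variance\<close> is infinite when square integrability fails, so a vanishing
  supremum forces integrability in all states at once. The variance speaks about the independent
  version, but integrability of the symbol terms depends on the marginals only.\<close>

lemma eventually_integrable_infos:
  assumes X: "X \<in> inputs A" and V: "variance_vanishes X"
  shows "\<forall>\<^sub>F n in sequentially. \<forall>s\<in>S. integrable_infos n (X n) s"
proof -
  have "\<forall>\<^sub>F n in sequentially. (SUP s\<in>S. info_rate_variance A B p w X s n) < 1"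
    using order_tendstoD(2)[OF V, of 1] by simp
  then show ?thesis
  proof eventually_elim
    case (elim n)
    show ?case
    proof
      fix s assume s: "s \<in> S"
      interpret I: memoryless_law A B n "independent_version A X n" "p s n" "w s n"
        using memoryless_inputs_subset independent_version_memoryless[OF X] s
        by (intro memoryless_law) auto
      have "info_rate_variance A B p w X s n < 1"
        by (rule le_less_trans[OF SUP_upper[OF s] elim])
      then have "ext_variance I.J (\<lambda>z. I.sum_info z / real n) < \<infinity>"
        unfolding info_rate_variance_eq[OF X s]
        by (rule less_trans) simp
      then have "integrable I.J I.sum_info"
        by (rule I.integrable_sum_info_if_variance)
      then have "integrable_infos n (independent_version A X n) s"
        unfolding integrable_infos_def using I.integrable_symbol_info by simp
      then show "integrable_infos n (X n) s"
        by (simp add: integrable_infos_independent_version[OF X])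
    qed
  qed
qed

lemma mean_info_ge:
  assumes X: "X \<in> inputs A" and s: "s \<in> S" and int: "integrable_infos n (X n) s"
    and tail: "info_tail n (X n) R s \<le> ennreal e" and e: "0 \<le> e" and R: "0 \<le> R"
  shows "real n * R * (1 - e) \<le> mean_info n (X n) s + 1"
proof -
  interpret I: memoryless_law A B n "X n" "p s n" "w s n"
    using X s by (rule memoryless_law)
  interpret J: prob_space I.J by (rule I.prob_space_J)
  let ?L = "{z \<in> space I.J. I.i (fst z) (snd z) / real n \<le> R}"
  have "measure I.J ?L \<le> e"
    using tail e unfolding info_tail_def Let_def by (simp add: J.emeasure_eq_measure)
  moreover have L: "?L \<in> sets I.J"
    using I.measurable_info_J by measurable
  moreover have "{z \<in> space I.J. R < I.i (fst z) (snd z) / real n} = space I.J - ?L" by auto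
  ultimately have "1 - e \<le> measure I.J {z \<in> space I.J. R < I.i (fst z) (snd z) / real n}"
    by (simp add: J.prob_compl)
  then have "real n * R * (1 - e) \<le> real n * R * measure I.J {z \<in> space I.J. R < I.i (fst z) (snd z) / real n}"
    using R by (intro mult_left_mono) auto
  also have "\<dots> \<le> mean_info n (X n) s + 1"
    unfolding mean_info_def using int R by (intro I.rate_bound) (auto simp: integrable_infos_def)
  finally show ?thesis .
qed

text \<open>The loss in \<open>mean_info_ge\<close>, a factor \<open>1 - e\<close> and the summand
  1, is absorbed by the gap \<open>R - R'\<close> for large \<open>n\<close>, uniformly in the
  state.\<close>

lemma eventually_mean_info_ge:
  assumes X: "X \<in> inputs A" and V: "variance_vanishes X"
    and R: "info_rate_ge X R" and less: "R' < R"
  shows "\<forall>\<^sub>F n in sequentially. \<forall>s\<in>S. real n * R' \<le> mean_info n (X n) s"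
proof (cases "0 \<le> R")
  case True
  define d where "d = R - R'"
  have d: "0 < d" using less by (simp add: d_def)
  \<comment> \<open>Half of the gap pays for \<open>R * e\<close>, the other half for the summand 1;
    \<open>R + 1\<close> avoids dividing by 0.\<close>
  define e where "e = d / (2 * (R + 1))"
  have e: "0 < e" using d True by (simp add: e_def)
  have Re: "R * e \<le> d / 2" using True d by (simp add: e_def field_simps)
  have "\<forall>\<^sub>F n in sequentially. (SUP s\<in>S. info_tail n (X n) R s) < ennreal e"
    using order_tendstoD(2)[OF R, of "ennreal e"] e by simp
  moreover have "\<forall>\<^sub>F n in sequentially. 2 / d \<le> real n"
    using filterlim_real_sequentially by (rule filterlim_at_top[THEN iffD1, rule_format])
  ultimately show ?thesis
    using eventually_integrable_infos[OF X V]
  proof eventually_elim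
    case (elim n)
    show ?case
    proof
      fix s assume s: "s \<in> S"
      have "info_tail n (X n) R s \<le> ennreal e"
        using elim(1) s by (intro order.trans[OF SUP_upper less_imp_le])
      then have "real n * R * (1 - e) \<le> mean_info n (X n) s + 1"
        using mean_info_ge[OF X s] elim(3) s e True by simp
      moreover have "real n * (R * e) \<le> real n * (d / 2)"
        using Re by (intro mult_left_mono) auto
      moreover have "1 \<le> real n * (d / 2)" using elim(2) d by (simp add: field_simps)
      ultimately show "real n * R' \<le> mean_info n (X n) s"
        by (simp add: d_def algebra_simps)
    qed
  qed
next
  case False
  \<comment> \<open>Negative rates belong to the supremum too. Rate 0 in \<open>rate_bound\<close>
    gives a mean of at least -1, which suffices once \<open>- n * R'\<close> reaches 1.\<close>
  then have R': "R' < 0" using less by simp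
  have "\<forall>\<^sub>F n in sequentially. 1 / (- R') \<le> real n"
    using filterlim_real_sequentially by (rule filterlim_at_top[THEN iffD1, rule_format])
  then show ?thesis
    using eventually_integrable_infos[OF X V]
  proof eventually_elim
    case (elim n)
    show ?case
    proof
      fix s assume s: "s \<in> S"
      interpret I: memoryless_law A B n "X n" "p s n" "w s n"
        using X s by (rule memoryless_law)
      have "0 \<le> mean_info n (X n) s + 1"
        unfolding mean_info_def using I.rate_bound[of 0] elim(2) s by (simp add: integrable_infos_def)
      moreover have "1 \<le> real n * (- R')"
        using elim(1) R' by (simp add: field_simps)
      ultimately show "real n * R' \<le> mean_info n (X n) s" by simp
    qed
  qed
qed

lemma info_tail_independent_le:
  assumes X: "X \<in> inputs A" and s: "s \<in> S" and int: "integrable_infos n (X n) s"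
    and mean: "real n * R \<le> mean_info n (X n) s" and n: "0 < n" and g: "0 < g"
  shows "info_tail n (independent_version A X n) (R - g) s
    \<le> info_rate_variance A B p w X s n / ennreal (g\<^sup>2)"
proof -
  let ?P = "independent_version A X n"
  interpret I: memoryless_law A B n ?P "p s n" "w s n"
    using memoryless_inputs_subset independent_version_memoryless[OF X] s
    by (intro memoryless_law) auto
  have int': "integrable (I.symbol_law k) (\<lambda>z. I.symbol_info k (fst z) (snd z))" if "k < n" for k
    using int that unfolding integrable_infos_independent_version[OF X, symmetric]
    by (simp add: integrable_infos_def)
  \<comment> \<open>Idempotence of \<open>independent_version\<close> says that \<open>?P\<close> is
    the product of its own marginals, as \<open>AE_info_eq\<close> requires.\<close>
  have P: "?P = Pi\<^sub>M {..<n} I.marg"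
    using independent_version_idem[OF independent_version_memoryless[OF X], THEN fun_cong, of n]
    by (simp add: independent_version_def[of A "independent_version A X"])
  have "(\<integral>z. I.sum_info z / real n \<partial>I.J) = mean_info n ?P s / real n"
    using I.integral_sum_info[OF int'] by (simp add: mean_info_def)
  also have "\<dots> = mean_info n (X n) s / real n"
    by (simp only: mean_info_independent_version[OF X])
  finally have "(\<integral>z. I.sum_info z / real n \<partial>I.J) = mean_info n (X n) s / real n" .
  then have mean': "(R - g) + g \<le> (\<integral>z. I.sum_info z / real n \<partial>I.J)"
    using mean n by (simp add: field_simps)
  have "info_tail n ?P (R - g) s = emeasure I.J {z \<in> space I.J. I.sum_info z / real n \<le> R - g}"
    unfolding info_tail_def Let_def
  proof (rule emeasure_eq_AE)
    show "AE z in I.J. (z \<in> {z \<in> space I.J. I.i (fst z) (snd z) / real n \<le> R - g}) =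
        (z \<in> {z \<in> space I.J. I.sum_info z / real n \<le> R - g})"
      using I.AE_info_eq[OF P] by eventually_elim simp
  qed (use I.measurable_info_J I.measurable_sum_info in measurable)
  also have "\<dots> \<le> info_rate_variance A B p w X s n / ennreal (g\<^sup>2)"
    unfolding info_rate_variance_eq[OF X s]
    by (rule I.chebyshev_sum_info[OF g mean'])
  finally show ?thesis .
qed

text \<open>The lower bound on the means may come from a rate of \<open>X\<close> or from
  near-optimal symbol distributions; both uses occur below.\<close>

lemma info_rate_ge_independent_version:
  assumes X: "X \<in> inputs A" and V: "variance_vanishes X"
    and mean: "\<forall>\<^sub>F n in sequentially. \<forall>s\<in>S. real n * R \<le> mean_info n (X n) s" and less: "R' < R"
  shows "info_rate_ge (independent_version A X) R'"
proof -
  define g where "g = R - R'"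
  have g: "0 < g" using less by (simp add: g_def)
  have "\<forall>\<^sub>F n in sequentially. (SUP s\<in>S. info_tail n (independent_version A X n) R' s)
      \<le> inverse (ennreal (g\<^sup>2)) * (SUP s\<in>S. info_rate_variance A B p w X s n)"
    using mean eventually_integrable_infos[OF X V] eventually_gt_at_top[of 0]
  proof eventually_elim
    case (elim n)
    show ?case
    proof (rule SUP_least)
      fix s assume s: "s \<in> S"
      have "info_tail n (independent_version A X n) R' s
          \<le> info_rate_variance A B p w X s n / ennreal (g\<^sup>2)"
        using info_tail_independent_le[OF X s _ _ _ g, of n R] elim s by (simp add: g_def)
      also have "\<dots> = inverse (ennreal (g\<^sup>2)) * info_rate_variance A B p w X s n"
        by (simp add: divide_ennreal_def mult.commute)
      also have "\<dots> \<le> inverse (ennreal (g\<^sup>2)) * (SUP s\<in>S. info_rate_variance A B p w X s n)"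
        using s by (intro mult_left_mono SUP_upper) auto
      finally show "info_tail n (independent_version A X n) R' s \<le> \<dots>" .
    qed
  qed
  moreover have "(\<lambda>n. inverse (ennreal (g\<^sup>2)) * (SUP s\<in>S. info_rate_variance A B p w X s n)) \<longlonglongrightarrow> 0"
    using ennreal_tendsto_cmult[OF _ V, of "inverse (ennreal (g\<^sup>2))"] g
    by (simp add: ennreal_inverse_eq_top_iff less_top[symmetric])
  ultimately show ?thesis
    by (rule tendsto_sandwich[OF _ _ tendsto_const, rotated]) simp
qed

section \<open>Suprema over rates and inputs\<close>

lemma le_inf_info_rate: "info_rate_ge X R \<Longrightarrow> ereal R \<le> inf_info_rate B S p X"
  unfolding inf_info_rate_eq by (rule Sup_upper) blast

text \<open>All estimates lose an arbitrarily small amount of rate, so an upper bound is tested at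
  strictly smaller rates only.\<close>

lemma inf_info_rate_le:
  assumes "\<And>R R'. info_rate_ge X R \<Longrightarrow> R' < R \<Longrightarrow> ereal R' \<le> c"
  shows "inf_info_rate B S p X \<le> c"
  unfolding inf_info_rate_eq
proof (rule Sup_least, clarsimp)
  fix R assume R: "info_rate_ge X R"
  show "ereal R \<le> c"
  proof (rule dense_le)
    fix y assume y: "y < ereal R"
    then obtain R' where "y < ereal R'" "R' < R" using ereal_dense2[OF y] by auto
    then show "y \<le> c" using assms[OF R, of R'] by (meson less_imp_le order.trans)
  qed
qed

lemma inf_info_rate_le_independent_version:
  assumes X: "X \<in> inputs A" and V: "variance_vanishes X"
  shows "inf_info_rate B S p X \<le> inf_info_rate B S p (independent_version A X)"
proof (rule inf_info_rate_le)
  fix R R' assume R: "info_rate_ge X R" and less: "R' < R"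
  \<comment> \<open>One loss for the means, another for Chebyshev's inequality.\<close>
  obtain r where r: "R' < r" "r < R" using dense[OF less] by blast
  show "ereal R' \<le> inf_info_rate B S p (independent_version A X)"
    by (intro le_inf_info_rate info_rate_ge_independent_version[OF X V _ r(1)]
        eventually_mean_info_ge[OF X V R r(2)])
qed

lemma SUP_inputs_eq_SUP_memoryless_inputs:
  assumes V: "\<And>X. X \<in> inputs A \<Longrightarrow> variance_vanishes X"
  shows "(SUP X\<in>inputs A. inf_info_rate B S p X) = (SUP X\<in>memoryless_inputs A. inf_info_rate B S p X)"
proof (rule antisym)
  show "(SUP X\<in>inputs A. inf_info_rate B S p X) \<le> (SUP X\<in>memoryless_inputs A. inf_info_rate B S p X)"
    using inf_info_rate_le_independent_version[OF _ V] independent_version_memoryless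
    by (intro SUP_least) (blast intro: SUP_upper2)
  show "(SUP X\<in>memoryless_inputs A. inf_info_rate B S p X) \<le> (SUP X\<in>inputs A. inf_info_rate B S p X)"
    by (rule SUP_subset_mono[OF memoryless_inputs_subset order_refl])
qed

lemma sum_mutual_info_eq:
  assumes X: "X \<in> inputs A" and s: "s \<in> S" and int: "integrable_infos n (X n) s"
    and Q: "\<And>k. k < n \<Longrightarrow> Q k = symbol_marginal A (X n) k"
  shows "(\<Sum>k<n. mutual_info (Q k) B (w s n k)) = ereal (mean_info n (X n) s)"
proof -
  interpret I: memoryless_law A B n "X n" "p s n" "w s n"
    using X s by (rule memoryless_law)
  have "mutual_info (Q k) B (w s n k) = ereal (\<integral>z. I.symbol_info k (fst z) (snd z) \<partial>I.symbol_law k)"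
    if "k < n" for k
    unfolding Q[OF that] using int that by (intro I.mutual_info_eq) (auto simp: integrable_infos_def)
  then show ?thesis by (simp add: mean_info_def)
qed

text \<open>The variance hypothesis is not uniform over inputs. For the lower bound on the supremum,
  near-optimal symbol distributions are therefore chosen for each block length and strung together
  into one input, to which the hypothesis is applied; different block lengths need not be
  consistent.\<close>

lemma SUP_memoryless_inputs_eq_liminf:
  assumes V: "\<And>X. X \<in> inputs A \<Longrightarrow> variance_vanishes X"
  shows "(SUP X\<in>memoryless_inputs A. inf_info_rate B S p X)
    = liminf (\<lambda>n. SUP Q\<in>symbol_dists A n. INF s\<in>S.
        (\<Sum>k<n. mutual_info (Q k) B (w s n k)) / ereal (real n))" (is "_ = liminf ?G")
proof (rule antisym)
  show "(SUP X\<in>memoryless_inputs A. inf_info_rate B S p X) \<le> liminf ?G"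
  proof (intro SUP_least inf_info_rate_le)
    fix X R R' assume "X \<in> memoryless_inputs A" and R: "info_rate_ge X R" and less: "R' < R"
    then have X: "X \<in> inputs A" using memoryless_inputs_subset by auto
    have "\<forall>\<^sub>F n in sequentially. ereal R' \<le> ?G n"
      using eventually_mean_info_ge[OF X V[OF X] R less] eventually_integrable_infos[OF X V[OF X]]
        eventually_gt_at_top[of 0]
    proof eventually_elim
      case (elim n)
      have "ereal R' \<le> (INF s\<in>S. (\<Sum>k<n. mutual_info (symbol_marginal A (X n) k) B (w s n k)) / ereal (real n))"
      proof (rule INF_greatest)
        fix s assume s: "s \<in> S"
        have "R' \<le> mean_info n (X n) s / real n"
          using elim s by (simp add: field_simps)
        then show "ereal R' \<le> (\<Sum>k<n. mutual_info (symbol_marginal A (X n) k) B (w s n k)) / ereal (real n)"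
          using elim s by (subst sum_mutual_info_eq[OF X s]) auto
      qed
      also have "\<dots> \<le> ?G n"
        by (rule SUP_upper[OF symbol_marginal_in_symbol_dists[OF X]])
      finally show ?case .
    qed
    then show "ereal R' \<le> liminf ?G" by (rule Liminf_bounded)
  qed
next
  show "liminf ?G \<le> (SUP X\<in>memoryless_inputs A. inf_info_rate B S p X)" (is "_ \<le> ?C")
  proof (rule dense_le)
    fix y assume "y < liminf ?G"
    then obtain r where r: "y < ereal r" "ereal r < liminf ?G" using ereal_dense2 by blast
    obtain r' where r': "y < ereal r'" "r' < r" using ereal_dense2[OF r(1)] by auto
    have ev: "\<forall>\<^sub>F n in sequentially. ereal r < ?G n"
      by (rule less_LiminfD[OF r(2)])
    \<comment> \<open>An implication, so that a choice exists for every \<open>n\<close>, including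
      those where \<open>?G n\<close> does not exceed \<open>r\<close>.\<close>
    define good where "good n Q \<longleftrightarrow> Q \<in> symbol_dists A n \<and> (ereal r < ?G n \<longrightarrow>
      ereal r < (INF s\<in>S. (\<Sum>k<n. mutual_info (Q k) B (w s n k)) / ereal (real n)))" for n Q
    have "\<exists>Q. good n Q" for n
      using compound symbol_dists_nonempty[of A n]
      unfolding good_def less_SUP_iff compound_channel_def by blast
    then obtain Q where Q: "\<And>n. good n (Q n)" by metis
    define X where "X n = Pi\<^sub>M {..<n} (Q n)" for n
    have Xm: "X \<in> memoryless_inputs A"
      using Q unfolding memoryless_inputs_def X_def good_def by blast
    then have X: "X \<in> inputs A" using memoryless_inputs_subset by auto
    have Q_marg: "Q n k = symbol_marginal A (X n) k" if "k < n" for n k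
      unfolding X_def using Q[of n] that by (simp add: symbol_marginal_PiM good_def)
    have "\<forall>\<^sub>F n in sequentially. \<forall>s\<in>S. real n * r \<le> mean_info n (X n) s"
      using ev eventually_integrable_infos[OF X V[OF X]] eventually_gt_at_top[of 0]
    proof eventually_elim
      case (elim n)
      show ?case
      proof
        fix s assume s: "s \<in> S"
        have "ereal r < (INF s\<in>S. (\<Sum>k<n. mutual_info (Q n k) B (w s n k)) / ereal (real n))"
          using Q[of n] elim(1) by (simp add: good_def)
        also have "\<dots> \<le> (\<Sum>k<n. mutual_info (Q n k) B (w s n k)) / ereal (real n)"
          using s by (rule INF_lower)
        also have "\<dots> = ereal (mean_info n (X n) s / real n)"
          using elim s Q_marg by (subst sum_mutual_info_eq[OF X s]) auto
        finally show "real n * r \<le> mean_info n (X n) s"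
          using elim(3) by (simp add: field_simps)
      qed
    qed
    then have "info_rate_ge (independent_version A X) r'"
      using X V[OF X] r'(2) by (intro info_rate_ge_independent_version)
    then have "ereal r' \<le> inf_info_rate B S p X"
      unfolding independent_version_idem[OF Xm] by (rule le_inf_info_rate)
    also have "\<dots> \<le> ?C" using Xm by (rule SUP_upper)
    finally show "y \<le> ?C" using r'(1) by simp
  qed
qed

end

section \<open>Converse\<close>

text \<open>Lets the converse treat both criteria through the average error.\<close>

lemma average_error_le:
  assumes "1 \<le> M"
  shows "code_error Average_Error B p s n M c D \<le> code_error crit B p s n M c D"
proof (cases crit)
  case Maximum_Error
  let ?e = "SUP m\<in>{..<M}. message_error B p s n c D m"
  have "(\<Sum>m<M. message_error B p s n c D m) \<le> of_nat M * ?e"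
    using sum_bounded_above[of "{..<M}" "message_error B p s n c D" ?e] by (auto intro: SUP_upper)
  then have "(\<Sum>m<M. message_error B p s n c D m) / of_nat M \<le> ?e * of_nat M / of_nat M"
    by (intro divide_right_mono_ennreal) (simp add: mult.commute)
  also have "\<dots> = ?e"
    using assms by (intro ennreal_mult_divide_eq) (auto simp: ennreal_of_nat_eq_real_of_nat)
  finally show ?thesis using Maximum_Error by simp
qed simp

context compound_memoryless
begin

text \<open>Repeated codewords keep their multiplicity. The map is completed by \<open>c 0\<close>
  because only indices below \<open>M\<close> are known to give blocks; the fallback has probability
  0.\<close>

definition codeword_dist :: "nat \<Rightarrow> nat \<Rightarrow> (nat \<Rightarrow> nat \<Rightarrow> 'a) \<Rightarrow> (nat \<Rightarrow> 'a) measure" where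
  "codeword_dist n M c =
     distr (measure_pmf (pmf_of_set {..<M})) (block A n) (\<lambda>m. if m < M then c m else c 0)"

lemma codeword_map_measurable:
  assumes "is_code A B S n M c D"
  shows "(\<lambda>m. if m < M then c m else c 0) \<in> measurable (measure_pmf (pmf_of_set {..<M})) (block A n)"
  using assms by (auto simp: is_code_def)

lemma codeword_dist_in_prob_algebra:
  assumes "is_code A B S n M c D"
  shows "codeword_dist n M c \<in> space (prob_algebra (block A n))"
  using measure_pmf.prob_space_distr[OF codeword_map_measurable[OF assms]]
  by (simp add: codeword_dist_def space_prob_algebra)

lemma nn_integral_codeword_dist:
  assumes "is_code A B S n M c D" and g: "g \<in> borel_measurable (block A n)"
  shows "(\<integral>\<^sup>+ x. g x \<partial>codeword_dist n M c) = (\<Sum>m<M. g (c m)) / of_nat M"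
proof -
  have "1 \<le> M" using assms by (simp add: is_code_def)
  then have "{..<M} \<noteq> {}" by (auto simp: lessThan_empty_iff)
  then show ?thesis
    unfolding codeword_dist_def
    by (subst nn_integral_distr[OF codeword_map_measurable[OF assms(1)]])
       (simp_all add: g nn_integral_pmf_of_set)
qed

text \<open>The converse bound of Verdu and Han.\<close>

lemma info_tail_le_error:
  assumes code: "is_code A B S n M c D" and s: "s \<in> S" and n: "0 < n"
    and X: "channel_law (codeword_dist n M c) (block B n) (p s n)"
  shows "info_tail n (codeword_dist n M c) R s
    \<le> code_error Average_Error B p s n M c D + ennreal (exp (real n * R)) / of_nat M"
proof -
  let ?P = "codeword_dist n M c"
  interpret C: channel_law ?P "block B n" "p s n" by (rule X)
  have dens: "transition_density (block A n) (block B n) (p s n)"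
    using compound s by (auto simp: compound_channel_def)
  note [measurable] = transition_densityD(1)[OF dens]
  have M: "1 \<le> M" and c: "m < M \<Longrightarrow> c m \<in> space (block A n)"
    and D: "m < M \<Longrightarrow> D s m \<in> sets (block B n)" and disj: "disjoint_family_on (D s) {..<M}" for m
    using code s by (auto simp: is_code_def)
  have pm [measurable]: "p s n (c m) \<in> borel_measurable (block B n)" if "m < M" for m
    using measurable_compose[OF measurable_Pair1'[OF c[OF that]] transition_densityD(1)[OF dens]] by simp
  \<comment> \<open>The tail event freed of logarithm and quotient, so that it can be used where
    densities vanish.\<close>
  define L where "L = {z. p s n (fst z) (snd z) \<le> exp (real n * R) * C.q (snd z)}"
  define g where "g x = (\<integral>\<^sup>+ y. ennreal (p s n x y) * indicator L (x, y) \<partial>block B n)" for x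
  have L_meas: "(\<lambda>z. indicator L z :: ennreal) \<in> borel_measurable (block A n \<Otimes>\<^sub>M block B n)"
  proof -
    have "(\<lambda>z. p s n (fst z) (snd z)) \<in> borel_measurable (block A n \<Otimes>\<^sub>M block B n)"
      using transition_densityD(1)[OF dens] by (simp add: case_prod_beta')
    moreover have "(\<lambda>z. exp (real n * R) * C.q (snd z)) \<in> borel_measurable (block A n \<Otimes>\<^sub>M block B n)"
      using measurable_compose[OF measurable_snd C.measurable_q] by simp
    ultimately have "{z \<in> space (block A n \<Otimes>\<^sub>M block B n). z \<in> L} \<in> sets (block A n \<Otimes>\<^sub>M block B n)"
      unfolding L_def mem_Collect_eq by (rule borel_measurable_le)
    then show ?thesis
      by (subst borel_measurable_indicator_iff) (simp add: Int_def conj_commute)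
  qed
  have sets_P: "sets ?P = sets (block A n)" by (simp add: codeword_dist_def)
  have L_meas_P: "(\<lambda>z. indicator L z :: ennreal) \<in> borel_measurable (?P \<Otimes>\<^sub>M block B n)"
    using L_meas by (simp add: measurable_cong_sets[OF sets_pair_measure_cong[OF sets_P refl] refl])
  have "info_tail n ?P R s = (\<integral>\<^sup>+ z. indicator {z \<in> space C.J. C.i (fst z) (snd z) / real n \<le> R} z \<partial>C.J)"
  proof -
    have "(\<lambda>z. C.i (fst z) (snd z)) \<in> borel_measurable C.J"
      using C.measurable_i by (simp add: case_prod_beta' measurable_cong_sets[OF C.sets_J refl])
    then have "{z \<in> space C.J. C.i (fst z) (snd z) / real n \<le> R} \<in> sets C.J"
      by measurable
    then show ?thesis unfolding info_tail_def Let_def by simp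
  qed
  also have "\<dots> \<le> (\<integral>\<^sup>+ z. indicator L z \<partial>C.J)"
  proof (rule nn_integral_mono_AE, use C.AE_pos in eventually_elim)
    case (elim z)
    show ?case
    proof (cases "C.i (fst z) (snd z) / real n \<le> R")
      case True
      then have "ln (p s n (fst z) (snd z) / C.q (snd z)) \<le> real n * R"
        using n by (simp add: info_density_def field_simps)
      then have "exp (ln (p s n (fst z) (snd z) / C.q (snd z))) \<le> exp (real n * R)"
        by (simp only: exp_le_cancel_iff)
      moreover have "0 < p s n (fst z) (snd z) / C.q (snd z)" using elim by simp
      ultimately have "p s n (fst z) (snd z) / C.q (snd z) \<le> exp (real n * R)"
        by (simp only: exp_ln)
      then have "z \<in> L" using elim by (simp add: L_def field_simps)
      then show ?thesis by (simp add: indicator_def)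
    qed simp
  qed
  also have "\<dots> = (\<integral>\<^sup>+ x. g x \<partial>?P)"
    unfolding g_def by (rule C.nn_integral_J[OF L_meas_P])
  also have "\<dots> = (\<Sum>m<M. g (c m)) / of_nat M"
  proof (rule nn_integral_codeword_dist[OF code])
    have "(\<lambda>z. ennreal (case z of (x, y) \<Rightarrow> p s n x y) * indicator L z) \<in> borel_measurable (block A n \<Otimes>\<^sub>M block B n)"
      using L_meas transition_densityD(1)[OF dens] by measurable
    from C.B.borel_measurable_nn_integral_fst[OF this] show "g \<in> borel_measurable (block A n)"
      by (simp add: g_def[abs_def])
  qed
  also have "\<dots> \<le> ((\<Sum>m<M. message_error B p s n c D m) + ennreal (exp (real n * R))) / of_nat M"
  proof (rule divide_right_mono_ennreal)
    define T where "T = ennreal (exp (real n * R))"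
    have "g (c m) \<le> message_error B p s n c D m + T * (\<integral>\<^sup>+ y. ennreal (C.q y) * indicator (D s m) y \<partial>block B n)"
      if m: "m < M" for m
    proof -
      \<comment> \<open>Outside its decision region an output counts as an error of
        \<open>m\<close>; inside, membership in \<open>L\<close> trades the transition density for
        \<open>T\<close> times the output density.\<close>
      have "g (c m) \<le> (\<integral>\<^sup>+ y. ennreal (p s n (c m) y) * indicator (space (block B n) - D s m) y
          + T * (ennreal (C.q y) * indicator (D s m) y) \<partial>block B n)"
        unfolding g_def
      proof (rule nn_integral_mono)
        fix y assume y: "y \<in> space (block B n)"
        show "ennreal (p s n (c m) y) * indicator L (c m, y)
            \<le> ennreal (p s n (c m) y) * indicator (space (block B n) - D s m) y
              + T * (ennreal (C.q y) * indicator (D s m) y)"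
        proof (cases "y \<in> D s m")
          case True
          then show ?thesis
            by (auto simp: L_def T_def ennreal_mult'[symmetric] indicator_def intro: ennreal_leI)
        next
          case False
          then show ?thesis using y by (simp add: indicator_def)
        qed
      qed
      also have "\<dots> = (\<integral>\<^sup>+ y. ennreal (p s n (c m) y) * indicator (space (block B n) - D s m) y \<partial>block B n)
          + T * (\<integral>\<^sup>+ y. ennreal (C.q y) * indicator (D s m) y \<partial>block B n)"
        using m D[OF m] by (subst nn_integral_add) (auto simp: nn_integral_cmult intro!: borel_measurable_times_ennreal borel_measurable_indicator)
      also have "(\<integral>\<^sup>+ y. ennreal (p s n (c m) y) * indicator (space (block B n) - D s m) y \<partial>block B n)
          = message_error B p s n c D m"
        unfolding message_error_def using m D[OF m] by (subst emeasure_density) auto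
      finally show ?thesis .
    qed
    then have "(\<Sum>m<M. g (c m)) \<le> (\<Sum>m<M. message_error B p s n c D m
        + T * (\<integral>\<^sup>+ y. ennreal (C.q y) * indicator (D s m) y \<partial>block B n))"
      by (intro sum_mono) simp
    also have "\<dots> = (\<Sum>m<M. message_error B p s n c D m)
        + T * (\<Sum>m<M. \<integral>\<^sup>+ y. ennreal (C.q y) * indicator (D s m) y \<partial>block B n)"
      by (simp add: sum.distrib sum_distrib_left)
    also have "(\<Sum>m<M. \<integral>\<^sup>+ y. ennreal (C.q y) * indicator (D s m) y \<partial>block B n)
        = (\<Sum>m<M. emeasure (density (block B n) (\<lambda>y. ennreal (C.q y))) (D s m))"
      using D by (intro sum.cong refl) (simp add: emeasure_density)
    \<comment> \<open>The decision regions are disjoint, so their masses under the output density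
      add up to at most 1, whatever the number of codewords.\<close>
    also have "\<dots> = emeasure (density (block B n) (\<lambda>y. ennreal (C.q y))) (\<Union>m<M. D s m)"
      using D by (intro sum_emeasure disj) auto
    also have "\<dots> \<le> emeasure (density (block B n) (\<lambda>y. ennreal (C.q y))) (space (block B n))"
      using emeasure_space[of "density (block B n) (\<lambda>y. ennreal (C.q y))"] by simp
    also have "\<dots> = 1"
      using C.nn_integral_q by (simp add: emeasure_density cong: nn_integral_cong)
    finally show "(\<Sum>m<M. g (c m)) \<le> (\<Sum>m<M. message_error B p s n c D m) + ennreal (exp (real n * R))"
      by (simp add: T_def mult_left_mono add_left_mono)
  qed
  also have "\<dots> = code_error Average_Error B p s n M c D + ennreal (exp (real n * R)) / of_nat M"
    by (simp add: add_divide_distrib_ennreal)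
  finally show ?thesis .
qed

text \<open>The uniform distributions on the codewords of good codes form an input. Its rate reaches
  every \<open>r < R\<close>: once \<open>ln M / n\<close> stays above some \<open>r' > r\<close>,
  the term \<open>exp (n * r) / M\<close> decays exponentially.\<close>

lemma achievable_rate_le:
  assumes "achievable_rate crit A B S p R"
  shows "ereal R \<le> (SUP X\<in>inputs A. inf_info_rate B S p X)"
proof -
  obtain M c D where code: "\<And>n. is_code A B S n (M n) (c n) (D n)"
    and rate: "ereal R \<le> liminf (\<lambda>n. ereal (ln (real (M n)) / real n))"
    and err: "(\<lambda>n. SUP s\<in>S. code_error crit B p s n (M n) (c n) (D n)) \<longlonglongrightarrow> 0"
    using assms unfolding achievable_rate_def by blast
  define X where "X n = codeword_dist n (M n) (c n)" for n
  have X: "X \<in> inputs A"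
    using codeword_dist_in_prob_algebra[OF code] by (simp add: inputs_def X_def)
  have M: "1 \<le> M n" for n using code[of n] by (simp add: is_code_def)
  have "info_rate_ge X r" if less: "r < R" for r
  proof -
    obtain r' where r': "r < r'" "r' < R" using dense[OF less] by blast
    have "ereal r' < liminf (\<lambda>n. ereal (ln (real (M n)) / real n))"
      using r' rate by (meson ereal_less(2) less_ereal.simps(1) less_le_trans)
    then have "\<forall>\<^sub>F n in sequentially. ereal r' < ereal (ln (real (M n)) / real n)"
      by (rule less_LiminfD)
    then have "\<forall>\<^sub>F n in sequentially. (SUP s\<in>S. info_tail n (X n) r s)
        \<le> (SUP s\<in>S. code_error crit B p s n (M n) (c n) (D n)) + ennreal (exp (- (r' - r) * real n))"
      using eventually_gt_at_top[of 0]
    proof eventually_elim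
      case (elim n)
      have "real n * r' < ln (real (M n))" using elim by (simp add: field_simps)
      then have M_ge: "exp (real n * r') < real (M n)"
        using M[of n] by (metis exp_less_cancel_iff exp_ln of_nat_0_less_iff less_le_trans zero_less_one)
      have exp_le: "ennreal (exp (real n * r)) / of_nat (M n) \<le> ennreal (exp (- (r' - r) * real n))"
      proof -
        have "exp (real n * r) = exp (- (r' - r) * real n) * exp (real n * r')"
          by (simp add: exp_add[symmetric] algebra_simps)
        also have "\<dots> \<le> exp (- (r' - r) * real n) * real (M n)"
          using M_ge by (intro mult_left_mono) auto
        finally have "exp (real n * r) / real (M n) \<le> exp (- (r' - r) * real n)"
          using M[of n] by (simp add: field_simps)
        then show ?thesis
          using M[of n] by (simp add: ennreal_of_nat_eq_real_of_nat divide_ennreal)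
      qed
      show ?case
      proof (rule SUP_least)
        fix s assume s: "s \<in> S"
        interpret I: memoryless_law A B n "X n" "p s n" "w s n"
          using X s by (rule memoryless_law)
        have "info_tail n (X n) r s \<le> code_error Average_Error B p s n (M n) (c n) (D n)
            + ennreal (exp (real n * r)) / of_nat (M n)"
          unfolding X_def using I.channel_law_axioms elim(2)
          by (intro info_tail_le_error code s) (auto simp: X_def)
        also have "\<dots> \<le> (SUP s\<in>S. code_error crit B p s n (M n) (c n) (D n)) + ennreal (exp (- (r' - r) * real n))"
          by (intro add_mono exp_le SUP_upper2[OF s average_error_le[OF M]])
        finally show "info_tail n (X n) r s \<le> \<dots>" .
      qed
    qed
    moreover
    have "(\<lambda>n. (SUP s\<in>S. code_error crit B p s n (M n) (c n) (D n))
        + ennreal (exp (- (r' - r) * real n))) \<longlonglongrightarrow> 0 + ennreal 0"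
    proof (intro tendsto_add err tendsto_ennrealI)
      have "0 < r' - r" using r' by simp
      then show "(\<lambda>n. exp (- (r' - r) * real n)) \<longlonglongrightarrow> 0"
        by real_asymp
    qed
    then have "(\<lambda>n. (SUP s\<in>S. code_error crit B p s n (M n) (c n) (D n))
        + ennreal (exp (- (r' - r) * real n))) \<longlonglongrightarrow> 0" by simp
    ultimately show ?thesis
      by (rule tendsto_sandwich[OF _ _ tendsto_const, rotated]) simp
  qed
  then have ge: "ereal r \<le> inf_info_rate B S p X" if "r < R" for r
    using le_inf_info_rate that by blast
  have "ereal R \<le> inf_info_rate B S p X"
  proof (rule dense_le)
    fix y assume y: "y < ereal R"
    then obtain r where "y < ereal r" "r < R" using ereal_dense2[OF y] by auto
    then show "y \<le> inf_info_rate B S p X"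
      using ge[of r] by (meson less_imp_le order.trans)
  qed
  also have "\<dots> \<le> (SUP X\<in>inputs A. inf_info_rate B S p X)" using X by (rule SUP_upper)
  finally show ?thesis .
qed

lemma compound_capacity_le:
  "compound_capacity crit A B S p \<le> (SUP X\<in>inputs A. inf_info_rate B S p X)"
  unfolding compound_capacity_def using achievable_rate_le by (auto intro!: Sup_least)

end

section \<open>Random codebooks\<close>

text \<open>Expectation over \<open>M\<close> independent letters with weights \<open>\<pi>\<close>.
  The recursion on the first letter is the conditioning that the inductions use.\<close>

fun list_expect :: "'x set \<Rightarrow> ('x \<Rightarrow> real) \<Rightarrow> nat \<Rightarrow> ('x list \<Rightarrow> real) \<Rightarrow> real" where
  "list_expect X \<pi> 0 F = F []"
| "list_expect X \<pi> (Suc M) F = (\<Sum>x\<in>X. \<pi> x * list_expect X \<pi> M (\<lambda>xs. F (x # xs)))"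

text \<open>McDiarmid's condition. The surroundings \<open>ys\<close> and \<open>zs\<close> have
  arbitrary length, so it passes to \<open>F\<close> with its first letter fixed.\<close>

definition bounded_differences :: "'x set \<Rightarrow> real \<Rightarrow> ('x list \<Rightarrow> real) \<Rightarrow> bool" where
  "bounded_differences X d F \<longleftrightarrow>
     (\<forall>ys zs. \<forall>x\<in>X. \<forall>x'\<in>X. \<bar>F (ys @ x # zs) - F (ys @ x' # zs)\<bar> \<le> d)"

lemma exp_le_quadratic:
  fixes x :: real
  assumes "\<bar>x\<bar> \<le> 1"
  shows "exp x \<le> 1 + x + x\<^sup>2"
proof (cases "0 \<le> x")
  case True
  then show ?thesis using exp_bound assms by simp
next
  case False
  define y where "y = - x"
  have y: "0 \<le> y" "y \<le> 1" using False assms by (auto simp: y_def)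
  \<comment> \<open>The product equals \<open>1 + y^3\<close>.\<close>
  have "1 \<le> (1 + y) * (1 - y + y\<^sup>2)"
    using y by (simp add: algebra_simps power2_eq_square)
  also have "\<dots> \<le> exp y * (1 - y + y\<^sup>2)"
    using y exp_ge_add_one_self[of y] by (intro mult_right_mono) auto
  finally have "inverse (exp y) \<le> 1 - y + y\<^sup>2"
    by (simp add: field_simps)
  then show ?thesis by (simp add: y_def exp_minus)
qed

locale random_list =
  fixes X :: "'x set" and \<pi> :: "'x \<Rightarrow> real"
  assumes finite_X: "finite X" and weight_nonneg: "\<And>x. x \<in> X \<Longrightarrow> 0 \<le> \<pi> x"
    and weight_sum: "(\<Sum>x\<in>X. \<pi> x) = 1"
begin

abbreviation "E \<equiv> list_expect X \<pi>"

lemma E_const [simp]: "E M (\<lambda>_. c) = c"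
  by (induction M) (simp_all add: sum_distrib_right[symmetric] weight_sum)

lemma E_add: "E M (\<lambda>xs. F xs + G xs) = E M F + E M G"
  by (induction M arbitrary: F G) (simp_all add: sum.distrib distrib_left)

lemma E_cmult: "E M (\<lambda>xs. c * F xs) = c * E M F"
  by (induction M arbitrary: F) (simp_all add: sum_distrib_left mult_ac)

lemma E_diff: "E M (\<lambda>xs. F xs - G xs) = E M F - E M G"
  using E_add[of M F "\<lambda>xs. - 1 * G xs"] unfolding E_cmult by simp

lemma E_sum: "E M (\<lambda>xs. \<Sum>i\<in>I. F i xs) = (\<Sum>i\<in>I. E M (F i))"
  by (induction I rule: infinite_finite_induct) (simp_all add: E_add)

lemma E_mono:
  "(\<And>xs. length xs = M \<Longrightarrow> set xs \<subseteq> X \<Longrightarrow> F xs \<le> G xs) \<Longrightarrow> E M F \<le> E M G"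
proof (induction M arbitrary: F G)
  case (Suc M)
  have "E M (\<lambda>xs. F (x # xs)) \<le> E M (\<lambda>xs. G (x # xs))" if "x \<in> X" for x
    using that by (intro Suc.IH Suc.prems) auto
  then show ?case by (auto intro!: sum_mono mult_left_mono weight_nonneg)
qed simp

lemma E_less_exists:
  assumes "E M F < c"
  shows "\<exists>xs. length xs = M \<and> set xs \<subseteq> X \<and> F xs < c"
proof (rule ccontr)
  assume "\<not> ?thesis"
  then have "E M (\<lambda>_. c) \<le> E M F" by (intro E_mono) (simp add: not_less)
  with assms show False by simp
qed

text \<open>Hoeffding's lemma with a cruder constant: the linear term of
  \<open>exp_le_quadratic\<close> averages out.\<close>

lemma sum_weight_exp_le:
  assumes mean: "(\<Sum>x\<in>X. \<pi> x * t x) = 0" and bound: "\<And>x. x \<in> X \<Longrightarrow> \<bar>t x\<bar> \<le> d" and d: "d \<le> 1"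
  shows "(\<Sum>x\<in>X. \<pi> x * exp (t x)) \<le> exp (d\<^sup>2)"
proof -
  have "(\<Sum>x\<in>X. \<pi> x * exp (t x)) \<le> (\<Sum>x\<in>X. \<pi> x * (1 + t x + d\<^sup>2))"
  proof (intro sum_mono mult_left_mono weight_nonneg)
    fix x assume x: "x \<in> X"
    have "exp (t x) \<le> 1 + t x + (t x)\<^sup>2"
      using bound[OF x] d by (intro exp_le_quadratic) simp
    moreover have "(t x)\<^sup>2 \<le> d\<^sup>2"
      using bound[OF x] by (metis abs_ge_zero power2_abs power_mono)
    ultimately show "exp (t x) \<le> 1 + t x + d\<^sup>2" by simp
  qed
  also have "\<dots> = (\<Sum>x\<in>X. \<pi> x) + (\<Sum>x\<in>X. \<pi> x * t x) + (\<Sum>x\<in>X. \<pi> x) * d\<^sup>2"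
    by (simp add: distrib_left sum.distrib sum_distrib_right)
  also have "\<dots> = 1 + d\<^sup>2" by (simp add: mean weight_sum)
  also have "\<dots> \<le> exp (d\<^sup>2)" by (rule exp_ge_add_one_self)
  finally show ?thesis .
qed

text \<open>McDiarmid's martingale argument, one letter at a time. Given the first letter, the
  deviation splits into \<open>m - G x\<close>, centred and at most \<open>d\<close> in size, and
  the deviation of the other letters from their mean \<open>G x\<close>, left to the induction
  hypothesis.\<close>

lemma mgf_bounded_differences:
  assumes "bounded_differences X d F" "0 \<le> l" "l * d \<le> 1"
  shows "E M (\<lambda>xs. exp (l * (E M F - F xs))) \<le> exp (real M * (l * d)\<^sup>2)"
  using assms(1)
proof (induction M arbitrary: F)
  case (Suc M)
  define G where "G x = E M (\<lambda>xs. F (x # xs))" for x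
  define m where "m = (\<Sum>x\<in>X. \<pi> x * G x)"
  have m: "E (Suc M) F = m" by (simp add: m_def G_def)
  have G_diff: "G x - G x' \<le> d" if "x \<in> X" "x' \<in> X" for x x'
  proof -
    have "G x \<le> E M (\<lambda>xs. F (x' # xs) + d)"
      unfolding G_def
    proof (rule E_mono)
      fix xs
      show "F (x # xs) \<le> F (x' # xs) + d"
        using Suc.prems that unfolding bounded_differences_def
        by (elim allE[of _ "[]"] allE[of _ xs]) (force simp: abs_le_iff)
    qed
    then show ?thesis by (simp add: E_add G_def)
  qed
  \<comment> \<open>An average of pairwise differences, so a bound on pairs bounds the distance from
    the mean.\<close>
  have m_const: "m - G x = (\<Sum>x'\<in>X. \<pi> x' * (G x' - G x))" for x
    by (simp add: m_def right_diff_distrib sum_subtractf sum_distrib_right[symmetric] weight_sum)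
  have G_m: "\<bar>m - G x\<bar> \<le> d" if x: "x \<in> X" for x
  proof -
    have "\<bar>m - G x\<bar> \<le> (\<Sum>x'\<in>X. \<pi> x' * d)"
      unfolding m_const
    proof (intro order.trans[OF sum_abs] sum_mono)
      fix x' assume x': "x' \<in> X"
      have "\<bar>G x' - G x\<bar> \<le> d" using G_diff[OF x x'] G_diff[OF x' x] by simp
      then show "\<bar>\<pi> x' * (G x' - G x)\<bar> \<le> \<pi> x' * d"
        using weight_nonneg[OF x'] by (simp add: abs_mult mult_left_mono)
    qed
    then show ?thesis by (simp add: sum_distrib_right[symmetric] weight_sum)
  qed
  have "E (Suc M) (\<lambda>xs. exp (l * (m - F xs)))
      = (\<Sum>x\<in>X. \<pi> x * exp (l * (m - G x)) * E M (\<lambda>xs. exp (l * (G x - F (x # xs)))))"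
    by (simp add: E_cmult[symmetric] exp_add[symmetric] algebra_simps)
  also have "\<dots> \<le> (\<Sum>x\<in>X. \<pi> x * exp (l * (m - G x)) * exp (real M * (l * d)\<^sup>2))"
  proof (intro sum_mono mult_left_mono mult_nonneg_nonneg weight_nonneg)
    fix x assume x: "x \<in> X"
    have "bounded_differences X d (\<lambda>xs. F (x # xs))"
      unfolding bounded_differences_def
    proof safe
      fix ys zs a b assume "a \<in> X" "b \<in> X"
      then have "\<bar>F ((x # ys) @ a # zs) - F ((x # ys) @ b # zs)\<bar> \<le> d"
        using Suc.prems unfolding bounded_differences_def by blast
      then show "\<bar>F (x # ys @ a # zs) - F (x # ys @ b # zs)\<bar> \<le> d" by simp
    qed
    from Suc.IH[OF this] show "E M (\<lambda>xs. exp (l * (G x - F (x # xs)))) \<le> exp (real M * (l * d)\<^sup>2)"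
      by (simp add: G_def)
  qed auto
  also have "\<dots> = (\<Sum>x\<in>X. \<pi> x * exp (l * (m - G x))) * exp (real M * (l * d)\<^sup>2)"
    by (simp add: sum_distrib_right)
  also have "\<dots> \<le> exp ((l * d)\<^sup>2) * exp (real M * (l * d)\<^sup>2)"
  proof (intro mult_right_mono sum_weight_exp_le)
    have "(\<Sum>x\<in>X. \<pi> x * (l * (m - G x))) = (\<Sum>x\<in>X. l * m * \<pi> x - l * (\<pi> x * G x))"
      by (rule sum.cong) (simp_all add: algebra_simps)
    also have "\<dots> = l * m * (\<Sum>x\<in>X. \<pi> x) - l * (\<Sum>x\<in>X. \<pi> x * G x)"
      by (simp only: sum_subtractf sum_distrib_left)
    also have "\<dots> = 0" by (simp add: m_def[symmetric] weight_sum)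
    finally show "(\<Sum>x\<in>X. \<pi> x * (l * (m - G x))) = 0" .
    show "\<bar>l * (m - G x)\<bar> \<le> l * d" if "x \<in> X" for x
      using G_m[OF that] assms(2) by (simp add: abs_mult mult_left_mono)
  qed (use assms in auto)
  also have "\<dots> = exp (real (Suc M) * (l * d)\<^sup>2)"
    by (simp add: exp_add[symmetric] distrib_right)
  finally show ?case unfolding m .
qed simp

text \<open>Chernoff's bound for each \<open>k\<close>, then the probabilistic method: if the
  expected number of violated indices is below 1, some list violates none.\<close>

lemma concentration_union:
  assumes K: "finite K" and bd: "\<And>k. k \<in> K \<Longrightarrow> bounded_differences X d (F k)"
    and l: "0 \<le> l" "l * d \<le> 1" and mean: "\<And>k. k \<in> K \<Longrightarrow> a \<le> E M (F k)"
    and small: "real (card K) * exp (real M * (l * d)\<^sup>2 - l * t) < 1"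
  shows "\<exists>xs. length xs = M \<and> set xs \<subseteq> X \<and> (\<forall>k\<in>K. a - t < F k xs)"
proof -
  define bad where "bad k xs = (if F k xs \<le> a - t then 1 else 0 :: real)" for k xs
  have "E M (bad k) \<le> exp (real M * (l * d)\<^sup>2 - l * t)" if k: "k \<in> K" for k
  proof -
    have "E M (bad k) \<le> E M (\<lambda>xs. exp (- l * t) * exp (l * (E M (F k) - F k xs)))"
    proof (rule E_mono)
      fix xs
      show "bad k xs \<le> exp (- l * t) * exp (l * (E M (F k) - F k xs))"
      proof (cases "F k xs \<le> a - t")
        case True
        then have "l * t \<le> l * (E M (F k) - F k xs)"
          using mean[OF k] l(1) by (intro mult_left_mono) auto
        then show ?thesis using True by (simp add: bad_def exp_add[symmetric])
      qed (simp add: bad_def)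
    qed
    also have "\<dots> \<le> exp (- l * t) * exp (real M * (l * d)\<^sup>2)"
      unfolding E_cmult by (intro mult_left_mono mgf_bounded_differences bd[OF k] l) simp
    finally show ?thesis by (simp add: exp_add[symmetric] algebra_simps)
  qed
  then have "E M (\<lambda>xs. \<Sum>k\<in>K. bad k xs) \<le> real (card K) * exp (real M * (l * d)\<^sup>2 - l * t)"
    unfolding E_sum by (intro sum_bounded_above)
  then obtain xs where xs: "length xs = M" "set xs \<subseteq> X" "(\<Sum>k\<in>K. bad k xs) < 1"
    using E_less_exists[of M "\<lambda>xs. \<Sum>k\<in>K. bad k xs" 1] small by auto
  have "a - t < F k xs" if "k \<in> K" for k
  proof (rule ccontr)
    assume "\<not> a - t < F k xs"
    then have "1 \<le> (\<Sum>k\<in>K. bad k xs)"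
      using member_le_sum[OF that, of "\<lambda>k. bad k xs"] K by (auto simp: bad_def)
    with xs show False by simp
  qed
  with xs show ?thesis by blast
qed

end

section \<open>Maximum likelihood decoding of a random list\<close>

definition list_max :: "('x \<Rightarrow> real) \<Rightarrow> 'x list \<Rightarrow> real" where
  "list_max v xs = foldr (\<lambda>x. max (v x)) xs 0"

lemma list_max_simps [simp]:
  "list_max v [] = 0" "list_max v (x # xs) = max (v x) (list_max v xs)"
  by (simp_all add: list_max_def)

text \<open>\<open>max\<close> is nonexpansive in each argument.\<close>

lemma list_max_replace: "\<bar>list_max v (ys @ x # zs) - list_max v (ys @ x' # zs)\<bar> \<le> \<bar>v x - v x'\<bar>"
  by (induction ys) (auto simp: max_def abs_if)

lemma list_max_close:
  "(\<And>x. x \<in> set xs \<Longrightarrow> \<bar>v x - u x\<bar> \<le> e) \<Longrightarrow> 0 \<le> e \<Longrightarrow> \<bar>list_max v xs - list_max u xs\<bar> \<le> e"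
proof (induction xs)
  case (Cons x xs)
  then have "\<bar>list_max v xs - list_max u xs\<bar> \<le> e" "\<bar>v x - u x\<bar> \<le> e" by auto
  then show ?case by (auto simp: max_def abs_if split: if_splits)
qed simp

text \<open>The fold starts at 0, hence the sign condition.\<close>

lemma list_max_attained:
  "xs \<noteq> [] \<Longrightarrow> (\<And>x. x \<in> set xs \<Longrightarrow> 0 \<le> v x) \<Longrightarrow> \<exists>m<length xs. v (xs ! m) = list_max v xs"
proof (induction xs)
  case (Cons x xs)
  show ?case
  proof (cases "list_max v xs \<le> v x")
    case True
    then show ?thesis by (intro exI[of _ 0]) (simp add: max_absorb1)
  next
    case False
    then have "xs \<noteq> []" using Cons.prems(2)[of x] by auto
    then obtain m where "m < length xs" "v (xs ! m) = list_max v xs"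
      using Cons.IH Cons.prems by auto
    then show ?thesis using False by (intro exI[of _ "Suc m"]) simp
  qed
qed simp

text \<open>Runs over the ordered pairs of different positions: \<open>M * (M - 1)\<close> terms,
  each with independent factors when the list is random.\<close>

fun cross_sum :: "('x \<Rightarrow> real) \<Rightarrow> ('x \<Rightarrow> real) \<Rightarrow> 'x list \<Rightarrow> real" where
  "cross_sum a b [] = 0"
| "cross_sum a b (x # xs) = cross_sum a b xs + a x * sum_list (map b xs) + b x * sum_list (map a xs)"

text \<open>If exactly one entry satisfies \<open>\<theta>\<close>, its value is a lower bound for the maximum; if
  several do, the left-hand side is nonpositive.\<close>

lemma list_max_ge:
  fixes v :: "'x \<Rightarrow> real" and \<theta> :: "'x \<Rightarrow> bool"
  assumes "\<And>x. x \<in> set xs \<Longrightarrow> 0 \<le> v x"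
  defines "a \<equiv> \<lambda>x. v x * of_bool (\<theta> x)" and "b \<equiv> \<lambda>x. of_bool (\<theta> x)"
  shows "sum_list (map a xs) - cross_sum a b xs \<le> list_max v xs"
    and "0 \<le> cross_sum a b xs"
proof -
  have "sum_list (map a xs) - cross_sum a b xs \<le> list_max v xs \<and> 0 \<le> cross_sum a b xs"
    using assms(1)
  proof (induction xs)
    case (Cons x xs)
    then have IH: "sum_list (map a xs) - cross_sum a b xs \<le> list_max v xs" "0 \<le> cross_sum a b xs"
      by auto
    have nn: "0 \<le> sum_list (map a xs)" "0 \<le> sum_list (map b xs)"
      using Cons.prems by (auto intro!: sum_list_nonneg simp: a_def b_def)
    have vx: "0 \<le> v x" using Cons.prems by simp
    show ?case
    proof (cases "\<theta> x")
      case True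
      have "0 \<le> v x * sum_list (map b xs)" using vx nn by simp
      then show ?thesis using True IH nn by (simp add: a_def b_def)
    next
      case False
      then show ?thesis using IH by (simp add: a_def b_def)
    qed
  qed simp
  then show "sum_list (map a xs) - cross_sum a b xs \<le> list_max v xs" "0 \<le> cross_sum a b xs"
    by auto
qed

text \<open>The probability of correct decoding of the codebook \<open>xs\<close> under maximum likelihood
  decoding and uniformly distributed messages.\<close>

definition ml_success :: "'y set \<Rightarrow> ('x \<Rightarrow> 'y \<Rightarrow> real) \<Rightarrow> 'x list \<Rightarrow> real" where
  "ml_success Y v xs = (\<Sum>y\<in>Y. list_max (\<lambda>x. v x y) xs) / real (length xs)"

context random_list
begin

lemma E_sum_list: "E M (\<lambda>xs. sum_list (map a xs)) = real M * (\<Sum>x\<in>X. \<pi> x * a x)"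
proof (induction M)
  case (Suc M)
  then show ?case
    by (simp add: E_add distrib_left sum.distrib sum_distrib_right[symmetric] weight_sum)
       (simp add: algebra_simps)
qed simp

lemma E_cross_sum:
  "E M (cross_sum a b) = real M * (real M - 1) * (\<Sum>x\<in>X. \<pi> x * a x) * (\<Sum>x\<in>X. \<pi> x * b x)"
proof (induction M)
  case (Suc M)
  let ?a = "\<Sum>x\<in>X. \<pi> x * a x" and ?b = "\<Sum>x\<in>X. \<pi> x * b x"
  have "E (Suc M) (cross_sum a b)
      = (\<Sum>x\<in>X. \<pi> x * E M (cross_sum a b) + (\<pi> x * a x) * (real M * ?b) + (\<pi> x * b x) * (real M * ?a))"
    by (simp add: E_add E_cmult E_sum_list distrib_left mult.assoc)
  also have "\<dots> = E M (cross_sum a b) + ?a * (real M * ?b) + ?b * (real M * ?a)"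
    by (simp add: sum.distrib sum_distrib_right[symmetric] weight_sum)
  finally show ?case unfolding Suc.IH by (simp add: algebra_simps)
qed simp

text \<open>Maximum likelihood decoding is at least as good as deciding for the only codeword that
  passes the test \<open>\<theta>\<close>. The sent word passes with the probability given by the
  double sum. For a given output, words that pass have density above \<open>T\<close> times the
  average density, so a fresh word passes with probability at most \<open>1 / T\<close>, and
  competitors cost at most \<open>M / T\<close>.\<close>

lemma E_ml_success_ge:
  assumes Y: "finite Y" and v: "\<And>x y. x \<in> X \<Longrightarrow> y \<in> Y \<Longrightarrow> 0 \<le> v x y"
    and v1: "\<And>x. x \<in> X \<Longrightarrow> (\<Sum>y\<in>Y. v x y) = 1"
    and \<theta>: "\<And>x y. x \<in> X \<Longrightarrow> y \<in> Y \<Longrightarrow> \<theta> x y \<Longrightarrow> T * (\<Sum>x'\<in>X. \<pi> x' * v x' y) < v x y"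
    and T: "0 < T" and M: "1 \<le> M"
  shows "(\<Sum>y\<in>Y. \<Sum>x\<in>X. \<pi> x * v x y * of_bool (\<theta> x y)) - real M / T \<le> E M (ml_success Y v)"
proof -
  define h where "h y = (\<Sum>x\<in>X. \<pi> x * (v x y * of_bool (\<theta> x y)))" for y
  define g where "g y = (\<Sum>x\<in>X. \<pi> x * of_bool (\<theta> x y))" for y
  define q where "q y = (\<Sum>x\<in>X. \<pi> x * v x y)" for y
  have h0: "0 \<le> h y" and g0: "0 \<le> g y" and hq: "h y \<le> q y" and gT: "T * q y * g y \<le> h y" if y: "y \<in> Y" for y
  proof -
    show "0 \<le> h y" "0 \<le> g y" unfolding h_def g_def
      using v y by (auto intro!: sum_nonneg mult_nonneg_nonneg weight_nonneg)
    show "h y \<le> q y" unfolding h_def q_def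
      using v y by (intro sum_mono mult_left_mono weight_nonneg) auto
    have "T * q y * g y = (\<Sum>x\<in>X. \<pi> x * (T * q y * of_bool (\<theta> x y)))"
      unfolding g_def by (simp add: sum_distrib_left mult_ac)
    also have "\<dots> \<le> h y" unfolding h_def
      using \<theta>[of _ y] y by (intro sum_mono mult_left_mono weight_nonneg) (auto simp: q_def intro: less_imp_le)
    finally show "T * q y * g y \<le> h y" .
  qed
  \<comment> \<open>Where \<open>q y = 0\<close> the division is impossible, but \<open>h y\<close>
    vanishes.\<close>
  have hg: "h y * g y \<le> h y / T" if y: "y \<in> Y" for y
  proof (cases "q y = 0")
    case True
    then have "h y = 0" using h0[OF y] hq[OF y] by simp
    then show ?thesis by simp
  next
    case False
    then have q: "0 < q y" using h0[OF y] hq[OF y] by simp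
    have "T * q y * g y \<le> q y" using gT[OF y] hq[OF y] by simp
    then have "g y \<le> 1 / T" using q T by (simp add: field_simps)
    then have "h y * g y \<le> h y * (1 / T)" using h0[OF y] by (intro mult_left_mono)
    then show ?thesis by simp
  qed
  have "(\<Sum>y\<in>Y. h y) \<le> (\<Sum>y\<in>Y. q y)" by (intro sum_mono hq)
  also have "\<dots> = (\<Sum>x\<in>X. \<pi> x * (\<Sum>y\<in>Y. v x y))"
    unfolding q_def by (subst sum.swap) (simp add: sum_distrib_left)
  also have "\<dots> = 1" by (simp add: v1 weight_sum)
  finally have h1: "(\<Sum>y\<in>Y. h y) \<le> 1" .
  have "(\<Sum>y\<in>Y. h y) - real M / T \<le> (\<Sum>y\<in>Y. h y) - real M * ((\<Sum>y\<in>Y. h y) / T)"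
    using h1 T by (simp add: field_simps mult_left_le)
  also have "\<dots> = (\<Sum>y\<in>Y. h y - real M * (h y / T))"
    by (simp add: sum_subtractf sum_distrib_left sum_divide_distrib)
  also have "\<dots> \<le> (\<Sum>y\<in>Y. h y - (real M - 1) * (h y * g y))"
  proof (intro sum_mono diff_left_mono)
    fix y assume y: "y \<in> Y"
    have "(real M - 1) * (h y * g y) \<le> real M * (h y * g y)"
      using h0[OF y] g0[OF y] by (intro mult_right_mono) auto
    also have "\<dots> \<le> real M * (h y / T)"
      using hg[OF y] by (intro mult_left_mono) auto
    finally show "(real M - 1) * (h y * g y) \<le> real M * (h y / T)" .
  qed
  \<comment> \<open>A list has \<open>M\<close> entries and \<open>M * (M - 1)\<close> ordered
    pairs; dividing by \<open>M\<close> leaves the factor \<open>M - 1\<close> of the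
    competitors.\<close>
  also have "\<dots> = E M (\<lambda>xs. 1 / real M * (\<Sum>y\<in>Y. sum_list (map (\<lambda>x. v x y * of_bool (\<theta> x y)) xs)
      - cross_sum (\<lambda>x. v x y * of_bool (\<theta> x y)) (\<lambda>x. of_bool (\<theta> x y)) xs))"
    unfolding E_cmult E_sum E_diff E_sum_list E_cross_sum h_def[symmetric] g_def[symmetric] sum_distrib_left
    using M by (intro sum.cong refl) (simp add: field_simps)
  also have "\<dots> \<le> E M (ml_success Y v)"
  proof (rule E_mono)
    fix xs assume xs: "length xs = M" "set xs \<subseteq> X"
    have "(\<Sum>y\<in>Y. sum_list (map (\<lambda>x. v x y * of_bool (\<theta> x y)) xs)
      - cross_sum (\<lambda>x. v x y * of_bool (\<theta> x y)) (\<lambda>x. of_bool (\<theta> x y)) xs)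
        \<le> (\<Sum>y\<in>Y. list_max (\<lambda>x. v x y) xs)"
      using v xs by (intro sum_mono list_max_ge) auto
    then show "1 / real M * (\<Sum>y\<in>Y. sum_list (map (\<lambda>x. v x y * of_bool (\<theta> x y)) xs)
      - cross_sum (\<lambda>x. v x y * of_bool (\<theta> x y)) (\<lambda>x. of_bool (\<theta> x y)) xs) \<le> ml_success Y v xs"
      unfolding ml_success_def using xs by (simp add: divide_right_mono)
  qed
  finally show ?thesis unfolding h_def by (simp add: mult.assoc)
qed

end

text \<open>The sum moves by at most the L1 distance of two output distributions, whence 2.\<close>

lemma ml_success_replace:
  assumes Y: "finite Y" and v: "\<And>x y. x \<in> X \<Longrightarrow> y \<in> Y \<Longrightarrow> 0 \<le> v x y"
    and v1: "\<And>x. x \<in> X \<Longrightarrow> (\<Sum>y\<in>Y. v x y) = 1" and x: "x \<in> X" "x' \<in> X"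
  shows "\<bar>(\<Sum>y\<in>Y. list_max (\<lambda>x. v x y) (ys @ x # zs)) - (\<Sum>y\<in>Y. list_max (\<lambda>x. v x y) (ys @ x' # zs))\<bar> \<le> 2"
proof -
  have "\<bar>(\<Sum>y\<in>Y. list_max (\<lambda>x. v x y) (ys @ x # zs)) - (\<Sum>y\<in>Y. list_max (\<lambda>x. v x y) (ys @ x' # zs))\<bar>
      \<le> (\<Sum>y\<in>Y. \<bar>v x y - v x' y\<bar>)"
    unfolding sum_subtractf[symmetric]
    by (intro order.trans[OF sum_abs] sum_mono list_max_replace)
  also have "\<dots> \<le> (\<Sum>y\<in>Y. v x y + v x' y)"
  proof (intro sum_mono)
    fix y assume "y \<in> Y"
    then show "\<bar>v x y - v x' y\<bar> \<le> v x y + v x' y"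
      using v[OF x(1), of y] v[OF x(2), of y] by simp
  qed
  also have "\<dots> = 2" by (simp add: sum.distrib v1 x)
  finally show ?thesis .
qed

lemma (in random_list) ex_codebook:
  assumes K: "finite K" and Y: "finite Y"
    and v: "\<And>k x y. k \<in> K \<Longrightarrow> x \<in> X \<Longrightarrow> y \<in> Y \<Longrightarrow> 0 \<le> v k x y"
    and v1: "\<And>k x. k \<in> K \<Longrightarrow> x \<in> X \<Longrightarrow> (\<Sum>y\<in>Y. v k x y) = 1"
    and \<theta>: "\<And>k x y. k \<in> K \<Longrightarrow> x \<in> X \<Longrightarrow> y \<in> Y \<Longrightarrow> \<theta> k x y \<Longrightarrow>
      T * (\<Sum>x'\<in>X. \<pi> x' * v k x' y) < v k x y"
    and e: "\<And>k. k \<in> K \<Longrightarrow> 1 - e \<le> (\<Sum>y\<in>Y. \<Sum>x\<in>X. \<pi> x * v k x y * of_bool (\<theta> k x y))"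
    and T: "0 < T" and M: "1 \<le> M" and t: "0 < t" "t \<le> 4"
    and small: "real (card K) * exp (- real M * t\<^sup>2 / 16) < 1"
  shows "\<exists>xs. length xs = M \<and> set xs \<subseteq> X \<and> (\<forall>k\<in>K. 1 - e - real M / T - t < ml_success Y (v k) xs)"
proof -
  \<comment> \<open>\<open>ml_success\<close> divides by the length of the list; fixing the divisor makes the bounded
    differences property hold for lists of every length.\<close>
  define F where "F k xs = (\<Sum>y\<in>Y. list_max (\<lambda>x. v k x y) xs) / real M" for k xs
  have F: "F k xs = ml_success Y (v k) xs" if "length xs = M" for k xs
    using that by (simp add: F_def ml_success_def)
  have "\<exists>xs. length xs = M \<and> set xs \<subseteq> X \<and> (\<forall>k\<in>K. (1 - e - real M / T) - t < F k xs)"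
  proof (rule concentration_union[OF K])
    show "bounded_differences X (2 / real M) (F k)" if k: "k \<in> K" for k
      unfolding bounded_differences_def F_def diff_divide_distrib[symmetric]
      using ml_success_replace[where X = X and Y = Y and v = "v k", OF Y v[OF k] v1[OF k]] M
      by (auto intro!: divide_right_mono)
    \<comment> \<open>With \<open>d = 2 / M\<close> the exponent is
      \<open>4 * l^2 / M - l * t\<close>, minimal at \<open>l = M * t / 8\<close> with value
      \<open>- M * t^2 / 16\<close>. Then \<open>l * d = t / 4\<close>, which is why
      \<open>t \<le> 4\<close>.\<close>
    show "0 \<le> real M * t / 8" using t by simp
    show "real M * t / 8 * (2 / real M) \<le> 1" using t M by simp
    show "1 - e - real M / T \<le> E M (F k)" if k: "k \<in> K" for k
    proof -
      have "1 - e - real M / T \<le> E M (ml_success Y (v k))"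
        using E_ml_success_ge[where Y = Y and v = "v k" and \<theta> = "\<theta> k", OF Y v[OF k] v1[OF k] \<theta>[OF k] T M] e[OF k]
        by simp
      also have "\<dots> \<le> E M (F k)" by (rule E_mono) (simp add: F)
      finally show ?thesis .
    qed
    have "real M * (real M * t / 8 * (2 / real M))\<^sup>2 - real M * t / 8 * t = - real M * t\<^sup>2 / 16"
      using M by (simp add: power2_eq_square field_simps)
    then show "real (card K) * exp (real M * (real M * t / 8 * (2 / real M))\<^sup>2 - real M * t / 8 * t) < 1"
      using small by simp
  qed
  then show ?thesis using F by metis
qed

section \<open>Direct part for finite alphabets\<close>

lemma nn_integral_finite_space:
  assumes "finite \<Omega>" "sets P = Pow \<Omega>"
  shows "(\<integral>\<^sup>+ x. g x \<partial>P) = (\<Sum>x\<in>\<Omega>. emeasure P {x} * g x)"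
proof -
  have sp: "space P = \<Omega>" using sets_eq_imp_space_eq[of P "count_space \<Omega>"] assms by simp
  have "(\<integral>\<^sup>+ x. g x \<partial>P) = (\<integral>\<^sup>+ x. (\<Sum>a\<in>\<Omega>. g a * indicator {a} x) \<partial>P)"
  proof (rule nn_integral_cong)
    fix x assume "x \<in> space P"
    then show "g x = (\<Sum>a\<in>\<Omega>. g a * indicator {a} x)"
      using assms(1) by (simp add: sp indicator_def if_distrib sum.delta cong: if_cong)
  qed
  also have "\<dots> = (\<Sum>a\<in>\<Omega>. \<integral>\<^sup>+ x. g a * indicator {a} x \<partial>P)"
    using assms
    by (intro nn_integral_sum borel_measurable_times_ennreal borel_measurable_const
        borel_measurable_indicator) auto
  also have "\<dots> = (\<Sum>a\<in>\<Omega>. emeasure P {a} * g a)"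
    using assms by (intro sum.cong refl) (simp add: nn_integral_cmult_indicator mult.commute)
  finally show ?thesis .
qed

locale finite_compound = compound_memoryless +
  assumes finite_alphabets: "finite_alphabets A B"
begin

abbreviation "Xs (n::nat) \<equiv> Pi\<^sub>E {..<n} (\<lambda>_. space A)"
abbreviation "Ys (n::nat) \<equiv> Pi\<^sub>E {..<n} (\<lambda>_. space B)"

lemma finite_A: "finite (space A)" and sets_A: "sets A = Pow (space A)"
  and finite_B: "finite (space B)" and B_eq: "B = count_space (space B)"
  using finite_alphabets by (auto simp: finite_alphabets_def)

lemma finite_Xs: "finite (Xs n)" and finite_Ys: "finite (Ys n)"
  using finite_A finite_B by (simp_all add: finite_PiE)

lemma block_B: "block B n = count_space (Ys n)"
proof -
  have "block B n = Pi\<^sub>M {..<n} (\<lambda>_. count_space (space B))"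
    unfolding block_def by (subst B_eq) (rule refl)
  also have "\<dots> = count_space (Ys n)"
    using finite_B by (intro count_space_PiM_finite) (auto intro: countable_finite)
  finally show ?thesis .
qed

lemma space_block_A: "space (block A n) = Xs n"
  by (simp add: block_def space_PiM)

lemma sets_block_A: "sets (block A n) = Pow (Xs n)"
proof -
  have "sets (block A n) = sets (Pi\<^sub>M {..<n} (\<lambda>_. count_space (space A)))"
    unfolding block_def by (rule sets_PiM_cong) (simp_all add: sets_A)
  also have "Pi\<^sub>M {..<n} (\<lambda>_. count_space (space A)) = count_space (Xs n)"
    using finite_A by (intro count_space_PiM_finite) (auto intro: countable_finite)
  finally show ?thesis by simp
qed

lemma transition_density_p: "s \<in> S \<Longrightarrow> transition_density (block A n) (block B n) (p s n)"
  using compound by (auto simp: compound_channel_def)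

lemma p_nonneg: "s \<in> S \<Longrightarrow> x \<in> Xs n \<Longrightarrow> y \<in> Ys n \<Longrightarrow> 0 \<le> p s n x y"
  using transition_densityD(2)[OF transition_density_p] by (simp add: space_block_A block_B)

lemma sum_p:
  assumes "s \<in> S" "x \<in> Xs n"
  shows "(\<Sum>y\<in>Ys n. p s n x y) = 1"
proof -
  have "(\<integral>\<^sup>+ y. ennreal (p s n x y) \<partial>block B n) = 1"
    using transition_densityD(3)[OF transition_density_p] assms by (simp add: space_block_A)
  then have "ennreal (\<Sum>y\<in>Ys n. p s n x y) = 1"
    using p_nonneg[OF assms] by (simp add: block_B nn_integral_count_space_finite finite_Ys)
  then show ?thesis by simp
qed

lemma w_bounds:
  assumes s: "s \<in> S" and k: "k < n" and a: "a \<in> space A" and b: "b \<in> space B"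
  shows "0 \<le> w s n k a b" "w s n k a b \<le> 1"
proof -
  have td: "transition_density A B (w s n k)"
    using memoryless s k by (auto simp: memoryless_def)
  have nonneg: "0 \<le> w s n k a b'" if "b' \<in> space B" for b'
    using transition_densityD(2)[OF td a that] .
  then show "0 \<le> w s n k a b" using b .
  have "(\<integral>\<^sup>+ y. ennreal (w s n k a y) \<partial>count_space (space B)) = 1"
    using transition_densityD(3)[OF td a] B_eq by simp
  then have "(\<Sum>y\<in>space B. w s n k a y) = 1"
    using nonneg by (simp add: nn_integral_count_space_finite finite_B)
  then show "w s n k a b \<le> 1"
    using member_le_sum[of b "space B" "w s n k a"] nonneg b finite_B by auto
qed

lemma random_list_input:
  assumes P: "P \<in> space (prob_algebra (block A n))"
  shows "random_list (Xs n) (\<lambda>x. measure P {x})"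
proof
  interpret P: prob_space P using P by (simp add: space_prob_algebra)
  have sets: "sets P = Pow (Xs n)" using P by (simp add: space_prob_algebra sets_block_A)
  have sp: "space P = Xs n" using sets_eq_imp_space_eq[of P "count_space (Xs n)"] sets by simp
  show "finite (Xs n)" by (rule finite_Xs)
  show "(\<Sum>x\<in>Xs n. measure P {x}) = 1"
    using P.finite_measure_eq_sum_singleton[of "Xs n"] finite_Xs sets sp P.prob_space by auto
qed simp

text \<open>Turns the information density event into the threshold test of
  \<open>E_ml_success_ge\<close> with \<open>T = exp (n * R)\<close>.\<close>

lemma info_threshold:
  assumes P: "P \<in> space (prob_algebra (block A n))" and s: "s \<in> S"
    and x: "x \<in> Xs n" and y: "y \<in> Ys n" and R: "0 < R" and n: "0 < n"
    and less: "R < info_density P (p s n) x y / real n"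
  shows "exp (real n * R) * (\<Sum>x'\<in>Xs n. measure P {x'} * p s n x' y) < p s n x y"
proof -
  interpret P: prob_space P using P by (simp add: space_prob_algebra)
  have sets: "sets P = Pow (Xs n)" using P by (simp add: space_prob_algebra sets_block_A)
  define q where "q = (\<Sum>x'\<in>Xs n. measure P {x'} * p s n x' y)"
  have q0: "0 \<le> q" unfolding q_def using p_nonneg[OF s _ y] by (auto intro: sum_nonneg)
  have "(\<integral>\<^sup>+ x'. ennreal (p s n x' y) \<partial>P) = (\<Sum>x'\<in>Xs n. ennreal (measure P {x'} * p s n x' y))"
    unfolding nn_integral_finite_space[OF finite_Xs sets]
    using p_nonneg[OF s _ y] by (intro sum.cong refl) (simp add: P.emeasure_eq_measure ennreal_mult)
  also have "\<dots> = ennreal q"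
    unfolding q_def using p_nonneg[OF s _ y] by (intro sum_ennreal) auto
  finally have out: "output_density P (p s n) y = q"
    using q0 by (simp add: output_density_def)
  have less': "real n * R < ln (p s n x y / q)"
    using less n by (simp add: info_density_def out field_simps)
  have "0 < real n * R" using n R by simp
  then have ln_pos: "0 < ln (p s n x y / q)" using less' by linarith
  \<comment> \<open>\<open>ln 0 = 0\<close>, also after a division by zero, so a positive logarithm
    rules out the degenerate cases; this is where \<open>0 < R\<close> enters.\<close>
  then have "p s n x y / q \<noteq> 0" by (metis ln_0 less_irrefl)
  moreover have "0 \<le> p s n x y / q" using p_nonneg[OF s x y] q0 by simp
  ultimately have pos: "0 < p s n x y / q" by (metis less_le)
  then have q: "0 < q" using q0 by (cases "q = 0") auto
  have "exp (real n * R) < exp (ln (p s n x y / q))" using less' by (simp only: exp_less_cancel_iff)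
  then have "exp (real n * R) < p s n x y / q" by (simp only: exp_ln[OF pos])
  then show ?thesis using q by (simp add: q_def[symmetric] field_simps)
qed

lemma info_tail_complement:
  assumes X: "X \<in> inputs A" and s: "s \<in> S" and e: "0 \<le> e" "info_tail n (X n) R s \<le> ennreal e"
  shows "1 - e \<le> (\<Sum>y\<in>Ys n. \<Sum>x\<in>Xs n. measure (X n) {x} * p s n x y *
    of_bool (R < info_density (X n) (p s n) x y / real n))"
proof -
  interpret I: memoryless_law A B n "X n" "p s n" "w s n"
    using X s by (rule memoryless_law)
  interpret J: prob_space I.J by (rule I.prob_space_J)
  have sets: "sets (X n) = Pow (Xs n)" using I.sets_P by (simp add: sets_block_A)
  let ?L = "{z \<in> space I.J. I.i (fst z) (snd z) / real n \<le> R}"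
  let ?U = "{z \<in> space I.J. R < I.i (fst z) (snd z) / real n}"
  have L: "?L \<in> sets I.J" using I.measurable_info_J by measurable
  have U: "?U \<in> sets I.J" using I.measurable_info_J by measurable
  have U_eq: "?U = space I.J - ?L" by auto
  have "measure I.J ?L \<le> e"
    using e unfolding info_tail_def Let_def by (simp add: J.emeasure_eq_measure)
  then have "1 - e \<le> measure I.J ?U" unfolding U_eq using L by (simp add: J.prob_compl)
  moreover have "ennreal (measure I.J ?U) = ennreal (\<Sum>x\<in>Xs n. \<Sum>y\<in>Ys n. measure (X n) {x} * p s n x y *
    of_bool (R < I.i x y / real n))"
  proof -
    have "ennreal (measure I.J ?U) = (\<integral>\<^sup>+ z. indicator ?U z \<partial>I.J)"
      using U by (simp add: J.emeasure_eq_measure)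
    also have "\<dots> = (\<integral>\<^sup>+ x. \<integral>\<^sup>+ y. ennreal (p s n x y) * indicator ?U (x, y) \<partial>block B n \<partial>X n)"
      using U by (intro I.nn_integral_J borel_measurable_indicator) simp
    also have "\<dots> = (\<Sum>x\<in>Xs n. emeasure (X n) {x} * (\<Sum>y\<in>Ys n. ennreal (p s n x y) * indicator ?U (x, y)))"
      unfolding nn_integral_finite_space[OF finite_Xs sets] block_B
      by (simp add: nn_integral_count_space_finite[OF finite_Ys])
    also have "\<dots> = (\<Sum>x\<in>Xs n. \<Sum>y\<in>Ys n. ennreal (measure (X n) {x} * p s n x y *
        of_bool (R < I.i x y / real n)))"
      unfolding sum_distrib_left
    proof (intro sum.cong refl)
      fix x y assume x: "x \<in> Xs n" and y: "y \<in> Ys n"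
      have "(x, y) \<in> space I.J"
        using x y unfolding I.space_J I.space_P by (simp add: space_block_A block_B)
      then show "emeasure (X n) {x} * (ennreal (p s n x y) * indicator ?U (x, y))
          = ennreal (measure (X n) {x} * p s n x y * of_bool (R < I.i x y / real n))"
        using p_nonneg[OF s x y] by (simp add: I.emeasure_eq_measure ennreal_mult indicator_def)
    qed
    also have "\<dots> = ennreal (\<Sum>x\<in>Xs n. \<Sum>y\<in>Ys n. measure (X n) {x} * p s n x y *
        of_bool (R < I.i x y / real n))"
      using p_nonneg[OF s] by (simp add: sum_nonneg)
    finally show ?thesis .
  qed
  then have "measure I.J ?U = (\<Sum>x\<in>Xs n. \<Sum>y\<in>Ys n. measure (X n) {x} * p s n x y *
    of_bool (R < I.i x y / real n))"
    using p_nonneg[OF s] by (subst (asm) ennreal_inj) (auto intro!: sum_nonneg)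
  ultimately show ?thesis by (subst sum.swap) simp
qed

text \<open>The codebook is common to all states, only the regions vary. Each region collects
  outputs on which its codeword attains the maximum, so the likelihoods over all regions add up to
  the sum of the maxima.\<close>

lemma ml_code:
  assumes xs: "xs \<noteq> []" "set xs \<subseteq> Xs n"
  shows "\<exists>c D. is_code A B S n (length xs) c D \<and>
    (\<forall>s\<in>S. code_error Average_Error B p s n (length xs) c D = ennreal (1 - ml_success (Ys n) (p s n) xs))"
proof -
  let ?M = "length xs"
  \<comment> \<open>Choosing one maximiser settles ties: each output lies in exactly one
    region.\<close>
  define best where "best s y = (SOME m. m < ?M \<and> p s n (xs ! m) y = list_max (\<lambda>x. p s n x y) xs)" for s y
  have best: "best s y < ?M" "p s n (xs ! best s y) y = list_max (\<lambda>x. p s n x y) xs"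
    if "s \<in> S" "y \<in> Ys n" for s y
  proof -
    have "\<exists>m<?M. p s n (xs ! m) y = list_max (\<lambda>x. p s n x y) xs"
      using xs p_nonneg[OF that(1) _ that(2)] by (intro list_max_attained) auto
    then have "best s y < ?M \<and> p s n (xs ! best s y) y = list_max (\<lambda>x. p s n x y) xs"
      unfolding best_def by (rule someI_ex)
    then show "best s y < ?M" "p s n (xs ! best s y) y = list_max (\<lambda>x. p s n x y) xs" by auto
  qed
  define D where "D s m = {y \<in> Ys n. best s y = m}" for s m
  have xm: "xs ! m \<in> Xs n" if "m < ?M" for m using xs that by (meson nth_mem subsetD)
  have code: "is_code A B S n ?M (\<lambda>m. xs ! m) D"
    unfolding is_code_def
  proof (intro conjI ballI allI impI)
    show "1 \<le> ?M" using xs by (simp add: Suc_leI)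
    show "xs ! m \<in> space (block A n)" if "m < ?M" for m using xm[OF that] by (simp add: space_block_A)
    show "D s m \<in> sets (block B n)" for s m by (auto simp: block_B D_def)
    show "disjoint_family_on (D s) {..<?M}" for s by (auto simp: disjoint_family_on_def D_def)
  qed
  have "code_error Average_Error B p s n ?M (\<lambda>m. xs ! m) D = ennreal (1 - ml_success (Ys n) (p s n) xs)"
    if s: "s \<in> S" for s
  proof -
    have err: "message_error B p s n (\<lambda>m. xs ! m) D m = ennreal (1 - (\<Sum>y\<in>D s m. p s n (xs ! m) y))"
      if m: "m < ?M" for m
    proof -
      have "message_error B p s n (\<lambda>m. xs ! m) D m
          = (\<integral>\<^sup>+ y. ennreal (p s n (xs ! m) y) * indicator (Ys n - D s m) y \<partial>count_space (Ys n))"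
        unfolding message_error_def block_B by (subst emeasure_density) auto
      also have "\<dots> = (\<Sum>y\<in>Ys n. ennreal (p s n (xs ! m) y * indicator (Ys n - D s m) y))"
        by (simp add: nn_integral_count_space_finite[OF finite_Ys])
           (intro sum.cong refl, simp add: indicator_def)
      also have "\<dots> = ennreal (\<Sum>y\<in>Ys n. p s n (xs ! m) y * indicator (Ys n - D s m) y)"
        using p_nonneg[OF s xm[OF m]] by (intro sum_ennreal) auto
      also have "(\<Sum>y\<in>Ys n. p s n (xs ! m) y * indicator (Ys n - D s m) y) = (\<Sum>y\<in>Ys n - D s m. p s n (xs ! m) y)"
        using finite_Ys by (subst sum.mono_neutral_cong_right[of "Ys n" "Ys n - D s m"]) (auto simp: indicator_def)
      also have "\<dots> = 1 - (\<Sum>y\<in>D s m. p s n (xs ! m) y)"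
        using sum_p[OF s xm[OF m]] finite_Ys by (subst sum_diff) (auto simp: D_def)
      finally show ?thesis .
    qed
    have le1: "(\<Sum>y\<in>D s m. p s n (xs ! m) y) \<le> 1" if m: "m < ?M" for m
      unfolding sum_p[OF s xm[OF m], symmetric]
      using p_nonneg[OF s xm[OF m]] finite_Ys by (intro sum_mono2) (auto simp: D_def)
    have "(\<Sum>m<?M. \<Sum>y\<in>D s m. p s n (xs ! m) y) = (\<Sum>m<?M. \<Sum>y\<in>D s m. list_max (\<lambda>x. p s n x y) xs)"
      using best[OF s] by (intro sum.cong refl) (auto simp: D_def)
    also have "\<dots> = (\<Sum>y\<in>Ys n. list_max (\<lambda>x. p s n x y) xs)"
      unfolding D_def using best(1)[OF s] finite_Ys by (intro sum.group) auto
    finally have total: "(\<Sum>m<?M. \<Sum>y\<in>D s m. p s n (xs ! m) y) = (\<Sum>y\<in>Ys n. list_max (\<lambda>x. p s n x y) xs)" .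
    have "(\<Sum>m<?M. message_error B p s n (\<lambda>m. xs ! m) D m)
        = ennreal (\<Sum>m<?M. 1 - (\<Sum>y\<in>D s m. p s n (xs ! m) y))"
      using err le1 by (subst sum_ennreal[symmetric]) auto
    also have "\<dots> = ennreal (real ?M - (\<Sum>y\<in>Ys n. list_max (\<lambda>x. p s n x y) xs))"
      by (simp add: sum_subtractf total)
    finally have sum_err: "(\<Sum>m<?M. message_error B p s n (\<lambda>m. xs ! m) D m) = \<dots>" .
    have "0 \<le> (\<Sum>m<?M. 1 - (\<Sum>y\<in>D s m. p s n (xs ! m) y))" using le1 by (intro sum_nonneg) auto
    then have "0 \<le> real ?M - (\<Sum>y\<in>Ys n. list_max (\<lambda>x. p s n x y) xs)" by (simp add: sum_subtractf total)
    then have "code_error Average_Error B p s n ?M (\<lambda>m. xs ! m) D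
        = ennreal ((real ?M - (\<Sum>y\<in>Ys n. list_max (\<lambda>x. p s n x y) xs)) / real ?M)"
      using xs by (simp add: sum_err ennreal_of_nat_eq_real_of_nat divide_ennreal)
    then show ?thesis using xs by (simp add: ml_success_def diff_divide_distrib)
  qed
  with code show ?thesis by blast
qed

text \<open>The symbol transition probabilities are quantised rather than those of the block: the union
  bound would not survive a doubly exponential number of states.\<close>

lemma ex_quantisation:
  assumes K: "0 < K"
  obtains U where "U \<subseteq> S" "finite U" "card U \<le> (K + 1) ^ (n * card (space A) * card (space B))"
    and "\<And>s. s \<in> S \<Longrightarrow> \<exists>u\<in>U. \<forall>x\<in>Xs n. \<forall>y\<in>Ys n. \<bar>p s n x y - p u n x y\<bar> \<le> real n / real K"
proof -
  define I where "I = {..<n} \<times> space A \<times> space B"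
  define key where "key s = restrict (\<lambda>(k, a, b). nat \<lfloor>real K * w s n k a b\<rfloor>) I" for s
  have finI: "finite I" using finite_A finite_B by (simp add: I_def)
  have key: "key ` S \<subseteq> Pi\<^sub>E I (\<lambda>_. {..K})"
  proof clarify
    fix s assume s: "s \<in> S"
    show "key s \<in> Pi\<^sub>E I (\<lambda>_. {..K})"
    proof (rule PiE_I)
      fix z assume z: "z \<in> I"
      obtain k a b where kab: "z = (k, a, b)" by (cases z)
      have "real K * w s n k a b \<le> real K"
        using w_bounds[OF s, of k n a b] z kab by (intro mult_left_le) (auto simp: I_def)
      then show "key s z \<in> {..K}" using z kab by (simp add: key_def) linarith
    qed (simp add: key_def)
  qed
  have finPi: "finite (Pi\<^sub>E I (\<lambda>_. {..K}))" using finI by (intro finite_PiE) auto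
  have "card (key ` S) \<le> card (Pi\<^sub>E I (\<lambda>_. {..K}))" by (rule card_mono[OF finPi key])
  also have "\<dots> = (K + 1) ^ (n * card (space A) * card (space B))"
    using finI by (simp add: card_PiE I_def card_cartesian_product mult.assoc)
  finally have card: "card (key ` S) \<le> (K + 1) ^ (n * card (space A) * card (space B))" .
  \<comment> \<open>One representative per occupied cell, taken from \<open>S\<close> itself so that
    the random coding bounds apply to it.\<close>
  obtain U where U: "U \<subseteq> S" "inj_on key U" "key ` S = key ` U"
    using subset_image_inj[of "key ` S" key S] by auto
  have "finite (key ` S)" using key finPi by (rule finite_subset)
  then have finU: "finite U" using U by (simp add: finite_image_iff)
  have cardU: "card U = card (key ` S)" unfolding U(3) using U(2) by (simp add: card_image)
  have close: "\<exists>u\<in>U. \<forall>x\<in>Xs n. \<forall>y\<in>Ys n. \<bar>p s n x y - p u n x y\<bar> \<le> real n / real K" if s: "s \<in> S" for s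
  proof -
    obtain u where u: "u \<in> U" "key s = key u" using U(3) s by blast
    have uS: "u \<in> S" using u U by auto
    have w_close: "\<bar>w s n k a b - w u n k a b\<bar> \<le> 1 / real K"
      if kab: "k < n" "a \<in> space A" "b \<in> space B" for k a b
    proof -
      have "nat \<lfloor>real K * w s n k a b\<rfloor> = nat \<lfloor>real K * w u n k a b\<rfloor>"
        using fun_cong[OF u(2), of "(k, a, b)"] kab by (simp add: key_def I_def)
      moreover have "0 \<le> real K * w s n k a b" "0 \<le> real K * w u n k a b"
        using w_bounds(1)[OF s kab] w_bounds(1)[OF uS kab] by auto
      ultimately have "\<lfloor>real K * w s n k a b\<rfloor> = \<lfloor>real K * w u n k a b\<rfloor>"
        by (metis eq_nat_nat_iff zero_le_floor)
      then have "\<bar>real K * w s n k a b - real K * w u n k a b\<bar> \<le> 1" by linarith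
      then have "real K * \<bar>w s n k a b - w u n k a b\<bar> \<le> 1"
        by (simp add: right_diff_distrib[symmetric] abs_mult)
      then show ?thesis using K by (simp add: field_simps)
    qed
    have "\<bar>p s n x y - p u n x y\<bar> \<le> real n / real K" if x: "x \<in> Xs n" and y: "y \<in> Ys n" for x y
    proof -
      have prod: "p s' n x y = (\<Prod>k<n. w s' n k (x k) (y k))" if "s' \<in> S" for s'
        using memoryless that x y by (auto simp: memoryless_def space_block_A block_B)
      have xk: "x k \<in> space A" and yk: "y k \<in> space B" if "k < n" for k using x y that by auto
      \<comment> \<open>Products of numbers in [0, 1] differ by at most the sum of the differences
        of their factors.\<close>
      have "norm ((\<Prod>k<n. w s n k (x k) (y k)) - (\<Prod>k<n. w u n k (x k) (y k)))
          \<le> (\<Sum>k<n. norm (w s n k (x k) (y k) - w u n k (x k) (y k)))"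
        using w_bounds[OF s _ xk yk] w_bounds[OF uS _ xk yk] by (intro norm_prod_diff) auto
      also have "\<dots> \<le> (\<Sum>k<n. 1 / real K)"
        using w_close xk yk by (intro sum_mono) auto
      finally show ?thesis by (simp add: prod s uS)
    qed
    then show ?thesis using u by blast
  qed
  show thesis using that[OF U(1) finU _ close] card cardU by simp
qed

text \<open>Each of the \<open>card (space B) ^ n\<close> output blocks contributes at most
  \<open>n / K\<close>, so the grid has to be exponentially fine.\<close>

lemma ml_success_close:
  assumes xs: "xs \<noteq> []" "set xs \<subseteq> Xs n" and K: "0 < K"
    and close: "\<forall>x\<in>Xs n. \<forall>y\<in>Ys n. \<bar>p s n x y - p u n x y\<bar> \<le> real n / real K"
  shows "ml_success (Ys n) (p u n) xs \<le> ml_success (Ys n) (p s n) xs + real (card (space B)) ^ n * (real n / real K)"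
proof -
  have "(\<Sum>y\<in>Ys n. list_max (\<lambda>x. p u n x y) xs) \<le> (\<Sum>y\<in>Ys n. list_max (\<lambda>x. p s n x y) xs + real n / real K)"
  proof (rule sum_mono)
    fix y assume y: "y \<in> Ys n"
    have "\<bar>list_max (\<lambda>x. p s n x y) xs - list_max (\<lambda>x. p u n x y) xs\<bar> \<le> real n / real K"
      using close y xs by (intro list_max_close) auto
    then show "list_max (\<lambda>x. p u n x y) xs \<le> list_max (\<lambda>x. p s n x y) xs + real n / real K" by simp
  qed
  also have "\<dots> = (\<Sum>y\<in>Ys n. list_max (\<lambda>x. p s n x y) xs) + real (card (space B)) ^ n * (real n / real K)"
    by (simp add: sum.distrib card_PiE)
  finally have "ml_success (Ys n) (p u n) xs \<le> ml_success (Ys n) (p s n) xs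
      + real (card (space B)) ^ n * (real n / real K) / real (length xs)"
    unfolding ml_success_def add_divide_distrib[symmetric] by (rule divide_right_mono) simp
  also have "real (card (space B)) ^ n * (real n / real K) / real (length xs)
      \<le> real (card (space B)) ^ n * (real n / real K)"
    using xs divide_left_mono[of 1 "real (length xs)" "real (card (space B)) ^ n * (real n / real K)"]
    by (simp add: Suc_leI)
  finally show ?thesis by simp
qed

text \<open>The error has three sources: the tail \<open>e\<close> of the information density, the
  competing codewords, and \<open>2 * t\<close>, one \<open>t\<close> for the deviation of the
  codebook from the mean and one for passing from a quantised state to the true one.\<close>

lemma ex_code:
  assumes X: "X \<in> inputs A" and R: "0 < R" and n: "0 < n" and M: "1 \<le> M"
    and t: "0 < t" "t \<le> 4" and e: "0 \<le> e" "\<And>s. s \<in> S \<Longrightarrow> info_tail n (X n) R s \<le> ennreal e"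
    and K: "0 < K" "real (card (space B)) ^ n * (real n / real K) \<le> t"
    and small: "real (K + 1) ^ (n * card (space A) * card (space B)) * exp (- real M * t\<^sup>2 / 16) < 1"
  shows "\<exists>c D. is_code A B S n M c D \<and> (\<forall>s\<in>S. code_error Average_Error B p s n M c D
    \<le> ennreal (e + real M / exp (real n * R) + 2 * t))"
proof -
  have P: "X n \<in> space (prob_algebra (block A n))" using X by (simp add: inputs_def)
  interpret random_list "Xs n" "\<lambda>x. measure (X n) {x}" by (rule random_list_input[OF P])
  obtain U where U: "U \<subseteq> S" "finite U" "card U \<le> (K + 1) ^ (n * card (space A) * card (space B))"
    and close: "\<And>s. s \<in> S \<Longrightarrow> \<exists>u\<in>U. \<forall>x\<in>Xs n. \<forall>y\<in>Ys n. \<bar>p s n x y - p u n x y\<bar> \<le> real n / real K"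
    using ex_quantisation[OF K(1)] by metis
  have "\<exists>xs. length xs = M \<and> set xs \<subseteq> Xs n \<and>
    (\<forall>u\<in>U. 1 - e - real M / exp (real n * R) - t < ml_success (Ys n) (p u n) xs)"
  proof (rule ex_codebook[where \<theta> = "\<lambda>u x y. R < info_density (X n) (p u n) x y / real n"])
    have "real (card U) \<le> real (K + 1) ^ (n * card (space A) * card (space B))"
      using U(3) by (metis of_nat_le_iff of_nat_power)
    then have "real (card U) * exp (- real M * t\<^sup>2 / 16)
        \<le> real (K + 1) ^ (n * card (space A) * card (space B)) * exp (- real M * t\<^sup>2 / 16)"
      by (rule mult_right_mono) simp
    then show "real (card U) * exp (- real M * t\<^sup>2 / 16) < 1" using small by (rule le_less_trans)
  qed (use U(1) p_nonneg sum_p info_threshold[OF P _ _ _ R n] info_tail_complement[OF X _ e(1) e(2)] M t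
      in \<open>auto intro: U(2) finite_Ys\<close>)
  then obtain xs where xs: "length xs = M" "set xs \<subseteq> Xs n"
    and succ: "\<And>u. u \<in> U \<Longrightarrow> 1 - e - real M / exp (real n * R) - t < ml_success (Ys n) (p u n) xs" by blast
  have ne: "xs \<noteq> []" using xs M by auto
  obtain c D where code: "is_code A B S n M c D"
    and err: "\<And>s. s \<in> S \<Longrightarrow> code_error Average_Error B p s n M c D = ennreal (1 - ml_success (Ys n) (p s n) xs)"
    using ml_code[OF ne xs(2)] xs(1) by auto
  have "code_error Average_Error B p s n M c D \<le> ennreal (e + real M / exp (real n * R) + 2 * t)" if s: "s \<in> S" for s
  proof -
    obtain u where u: "u \<in> U" "\<forall>x\<in>Xs n. \<forall>y\<in>Ys n. \<bar>p s n x y - p u n x y\<bar> \<le> real n / real K"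
      using close[OF s] by blast
    have "1 - ml_success (Ys n) (p s n) xs \<le> e + real M / exp (real n * R) + 2 * t"
      using ml_success_close[OF ne xs(2) K(1) u(2)] succ[OF u(1)] K(2) by simp
    then show ?thesis unfolding err[OF s] by (rule ennreal_leI)
  qed
  with code show ?thesis by blast
qed

section \<open>Sequences of codes and the capacity\<close>

lemma ex_trivial_code:
  "\<exists>c D. is_code A B S n 1 c D \<and> (\<forall>s\<in>S. code_error Average_Error B p s n 1 c D = 0)"
proof -
  have "space A \<noteq> {}" using compound by (simp add: compound_channel_def)
  then have "Xs n \<noteq> {}" by (simp add: PiE_eq_empty_iff)
  then obtain x where x: "x \<in> Xs n" by blast
  have "is_code A B S n 1 (\<lambda>_. x) (\<lambda>_ _. space (block B n))"
    using x by (auto simp: is_code_def space_block_A disjoint_family_on_def)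
  moreover have "code_error Average_Error B p s n 1 (\<lambda>_. x) (\<lambda>_ _. space (block B n)) = 0" for s
    by (simp add: message_error_def)
  ultimately show ?thesis by blast
qed

text \<open>Covers the nonpositive rates in \<open>le_compound_capacity\<close>: a single codeword
  never errs.\<close>

lemma achievable_rate_0: "achievable_rate Average_Error A B S p 0"
proof -
  have "\<exists>c D. \<forall>n. is_code A B S n 1 (c n) (D n) \<and>
      (\<forall>s\<in>S. code_error Average_Error B p s n 1 (c n) (D n) = 0)"
    using ex_trivial_code by metis
  then obtain c D where code: "\<And>n. is_code A B S n 1 (c n) (D n)"
    "\<And>n s. s \<in> S \<Longrightarrow> code_error Average_Error B p s n 1 (c n) (D n) = 0" by blast
  have S: "S \<noteq> {}" using compound by (simp add: compound_channel_def)
  have "(SUP s\<in>S. code_error Average_Error B p s n 1 (c n) (D n)) = 0" for n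
    using S code(2) by (simp cong: SUP_cong)
  then have "(\<lambda>n. SUP s\<in>S. code_error Average_Error B p s n 1 (c n) (D n)) \<longlonglongrightarrow> 0"
    by simp
  moreover have "ereal 0 \<le> liminf (\<lambda>n. ereal (ln (real 1) / real n))"
    by (rule Liminf_bounded) simp
  ultimately show ?thesis
    unfolding achievable_rate_def using code(1) by (intro exI[of _ "\<lambda>_. 1"] exI[of _ c] exI[of _ D]) blast
qed

text \<open>The gap between \<open>r\<close> and \<open>R\<close> makes
  \<open>M / exp (n * R)\<close> vanish, and the tolerance \<open>t = 1 / n\<close> vanishes slowly
  enough for the union bound.\<close>

lemma achievable_rate_direct:
  assumes X: "X \<in> inputs A" and R: "info_rate_ge X R" and r: "0 < r" "r < R"
  shows "achievable_rate Average_Error A B S p r"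
proof -
  let ?a = "card (space A)" and ?b = "card (space B)"
  define M where "M n = nat \<lceil>exp (real n * r)\<rceil>" for n
  \<comment> \<open>The factor \<open>b\<^sup>n\<close> compensates for summing the quantisation error over all output blocks, and
    \<open>4\<^sup>n\<close> dominates \<open>n\<^sup>2\<close>.\<close>
  define K where "K n = (4 * (?b + 1)) ^ n" for n
  define e where "e n = enn2real (SUP s\<in>S. info_tail n (X n) R s)" for n
  define err where "err n = e n + real (M n) / exp (real n * R) + 2 * (1 / real n)" for n
  have M_ge: "exp (real n * r) \<le> real (M n)" for n
    unfolding M_def by (rule real_nat_ceiling_ge)
  have M_le: "real (M n) \<le> exp (real n * r) + 1" for n
    unfolding M_def using ceiling_correct[of "exp (real n * r)"] by simp
  have M1: "1 \<le> M n" for n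
    using order.trans[OF _ M_ge[of n], of 1] r(1) by simp
  have "\<forall>\<^sub>F n in sequentially. (SUP s\<in>S. info_tail n (X n) R s) < 1"
    using order_tendstoD(2)[OF R, of 1] by simp
  then have fin: "\<forall>\<^sub>F n in sequentially. (SUP s\<in>S. info_tail n (X n) R s) = ennreal (e n)"
    by eventually_elim (simp add: e_def ennreal_enn2real[OF less_trans[OF _ ennreal_one_less_top]])
  have e_lim: "e \<longlonglongrightarrow> 0"
  proof -
    have "(\<lambda>n. ennreal (e n)) \<longlonglongrightarrow> 0"
      using R by (rule Lim_transform_eventually) (use fin in \<open>auto elim: eventually_mono\<close>)
    then show ?thesis by (subst (asm) ennreal_tendsto_0_iff) (simp_all add: e_def)
  qed
  have err_lim: "err \<longlonglongrightarrow> 0"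
  proof -
    have "(\<lambda>n. (exp (real n * r) + 1) / exp (real n * R)) \<longlonglongrightarrow> 0"
      using r by real_asymp
    then have "(\<lambda>n. real (M n) / exp (real n * R)) \<longlonglongrightarrow> 0"
      by (rule tendsto_sandwich[OF _ _ tendsto_const, rotated 2])
         (auto intro!: always_eventually divide_right_mono M_le)
    moreover have "(\<lambda>n. 2 * (1 / real n)) \<longlonglongrightarrow> 0" by real_asymp
    ultimately have "(\<lambda>n. e n + real (M n) / exp (real n * R) + 2 * (1 / real n)) \<longlonglongrightarrow> 0 + 0 + 0"
      using e_lim by (intro tendsto_add)
    then show ?thesis by (simp add: err_def[abs_def])
  qed
  have K_small: "real ?b ^ n * (real n / real (K n)) \<le> 1 / real n" if "0 < n" for n
  proof -
    have "real n * real n \<le> 4 ^ n"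
    proof -
      have "real n \<le> 2 ^ n" using of_nat_less_two_power[of n, where 'a = real] by simp
      then have "real n * real n \<le> 2 ^ n * 2 ^ n" by (intro mult_mono) auto
      then show ?thesis by (simp add: power_mult_distrib[symmetric])
    qed
    moreover have "real ?b ^ n \<le> (real ?b + 1) ^ n" by (intro power_mono) auto
    ultimately have "real ?b ^ n * (real n * real n) \<le> (real ?b + 1) ^ n * 4 ^ n"
      by (intro mult_mono) auto
    also have "\<dots> = real (K n)"
      unfolding power_mult_distrib[symmetric] K_def of_nat_power
      by (rule arg_cong[where f = "\<lambda>z. z ^ n"]) simp
    finally have "real ?b ^ n * (real n * real n) \<le> real (K n)" .
    moreover have "0 < real (K n)" by (simp add: K_def)
    ultimately show ?thesis using that by (simp add: field_simps)
  qed
  \<comment> \<open>\<open>C\<close> is such that the number of quantised states is at most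
    \<open>exp (C * n^2)\<close>. Here \<open>8 = 2 * 4\<close>, the extra 2 absorbing the summand
    in \<open>K n + 1\<close>.\<close>
  define L where "L = ln (8 * (real ?b + 1))"
  define C where "C = real (?a * ?b) * L"
  have small: "\<forall>\<^sub>F n in sequentially.
      real (K n + 1) ^ (n * ?a * ?b) * exp (- real (M n) * (1 / real n)\<^sup>2 / 16) < 1"
  proof -
    \<comment> \<open>\<open>n^2\<close> from the number of quantised states times
      \<open>n^2\<close> from the tolerance \<open>1 / n\<close>, against \<open>M\<close>, which is
      exponential in \<open>n\<close>.\<close>
    have "(\<lambda>n. real n ^ 4 / exp (real n * r)) \<longlonglongrightarrow> 0" using r(1) by real_asymp
    then have "(\<lambda>n. 16 * C * (real n ^ 4 / exp (real n * r))) \<longlonglongrightarrow> 0"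
      by (rule tendsto_mult_right_zero)
    then have "\<forall>\<^sub>F n in sequentially. 16 * C * (real n ^ 4 / exp (real n * r)) < 1"
      by (rule order_tendstoD) simp
    then show ?thesis using eventually_gt_at_top[of 0]
    proof eventually_elim
      case (elim n)
      have "real (K n + 1) \<le> (8 * (real ?b + 1)) ^ n"
      proof -
        have "1 \<le> (4 * (real ?b + 1)) ^ n" by (intro one_le_power) simp
        then have "real (K n + 1) \<le> 2 * (4 * (real ?b + 1)) ^ n" by (simp add: K_def add.commute)
        also have "\<dots> \<le> 2 ^ n * (4 * (real ?b + 1)) ^ n"
          using elim(2) self_le_power[of "2::real" n] by (intro mult_right_mono) auto
        also have "\<dots> = (8 * (real ?b + 1)) ^ n" by (simp add: power_mult_distrib[symmetric])
        finally show ?thesis .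
      qed
      also have "\<dots> = exp (real n * L)"
        by (simp add: L_def exp_of_nat_mult)
      finally have "real (K n + 1) ^ (n * ?a * ?b) \<le> exp (real n * L) ^ (n * ?a * ?b)"
        by (intro power_mono) auto
      also have "\<dots> = exp (C * real n ^ 2)"
        by (simp add: exp_of_nat_mult[symmetric] C_def power2_eq_square mult_ac)
      finally have "real (K n + 1) ^ (n * ?a * ?b) * exp (- real (M n) * (1 / real n)\<^sup>2 / 16)
          \<le> exp (C * real n ^ 2) * exp (- real (M n) * (1 / real n)\<^sup>2 / 16)"
        by (rule mult_right_mono) simp
      also have "\<dots> = exp (C * real n ^ 2 - real (M n) / (16 * real n ^ 2))"
        by (simp add: exp_add[symmetric] power_divide)
      also have "\<dots> < 1"
      proof -
        have "16 * C * real n ^ 4 < exp (real n * r)" using elim(1) by (simp add: field_simps)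
        also have "\<dots> \<le> real (M n)" by (rule M_ge)
        finally have "C * real n ^ 2 < real (M n) / (16 * real n ^ 2)"
          using elim(2) by (simp add: field_simps power_add[symmetric])
        then show ?thesis by simp
      qed
      finally show ?case .
    qed
  qed
  \<comment> \<open>At the finitely many block lengths where some estimate fails, the trivial code
    stands in.\<close>
  define good where "good n \<longleftrightarrow> 0 < n \<and> (SUP s\<in>S. info_tail n (X n) R s) = ennreal (e n) \<and>
      real (K n + 1) ^ (n * ?a * ?b) * exp (- real (M n) * (1 / real n)\<^sup>2 / 16) < 1" for n
  have good: "\<forall>\<^sub>F n in sequentially. good n"
    using fin small eventually_gt_at_top[of 0] unfolding good_def by eventually_elim auto
  have "\<exists>M' c D. is_code A B S n M' c D \<and> (good n \<longrightarrow> M' = M n \<and>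
      (\<forall>s\<in>S. code_error Average_Error B p s n M' c D \<le> ennreal (err n)))" for n
  proof (cases "good n")
    case True
    have "info_tail n (X n) R s \<le> ennreal (e n)" if "s \<in> S" for s
      using True SUP_upper[OF that, of "info_tail n (X n) R"] by (simp add: good_def)
    then have "\<exists>c D. is_code A B S n (M n) c D \<and>
        (\<forall>s\<in>S. code_error Average_Error B p s n (M n) c D \<le> ennreal (err n))"
      unfolding err_def using True r M1 K_small[of n]
      by (intro ex_code[OF X, where K = "K n"]) (auto simp: good_def e_def K_def field_simps)
    then show ?thesis by blast
  next
    case False
    then show ?thesis using ex_trivial_code[of n] by blast
  qed
  then obtain M' c D where code: "\<And>n. is_code A B S n (M' n) (c n) (D n)"
    and M': "\<And>n. good n \<Longrightarrow> M' n = M n"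
    and error: "\<And>n s. good n \<Longrightarrow> s \<in> S \<Longrightarrow> code_error Average_Error B p s n (M' n) (c n) (D n) \<le> ennreal (err n)"
    by metis
  have "ereal r \<le> liminf (\<lambda>n. ereal (ln (real (M' n)) / real n))"
  proof (rule Liminf_bounded, use good in eventually_elim)
    case (elim n)
    have "real n * r = ln (exp (real n * r))" by simp
    also have "\<dots> \<le> ln (real (M' n))" unfolding M'[OF elim] using M_ge by (intro ln_mono) auto
    finally show ?case using elim by (simp add: good_def field_simps)
  qed
  moreover have "(\<lambda>n. SUP s\<in>S. code_error Average_Error B p s n (M' n) (c n) (D n)) \<longlonglongrightarrow> 0"
  proof (rule tendsto_sandwich[OF _ _ tendsto_const])
    show "\<forall>\<^sub>F n in sequentially. (SUP s\<in>S. code_error Average_Error B p s n (M' n) (c n) (D n)) \<le> ennreal (err n)"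
      using good by eventually_elim (rule SUP_least, rule error)
    show "(\<lambda>n. ennreal (err n)) \<longlonglongrightarrow> 0"
      using tendsto_ennrealI[OF err_lim] by simp
  qed simp
  ultimately show ?thesis unfolding achievable_rate_def using code by blast
qed

lemma le_compound_capacity:
  "(SUP X\<in>inputs A. inf_info_rate B S p X) \<le> compound_capacity Average_Error A B S p"
proof (intro SUP_least inf_info_rate_le)
  fix X R R' assume X: "X \<in> inputs A" and R: "info_rate_ge X R" and less: "R' < R"
  have cap: "ereal r \<le> compound_capacity Average_Error A B S p"
    if "achievable_rate Average_Error A B S p r" for r
    unfolding compound_capacity_def using that by (intro Sup_upper) blast
  show "ereal R' \<le> compound_capacity Average_Error A B S p"
  proof (cases "0 < R'")
    case True
    show ?thesis by (rule cap[OF achievable_rate_direct[OF X R True less]])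
  next
    case False
    then have "ereal R' \<le> ereal 0" by simp
    then show ?thesis using cap[OF achievable_rate_0] by (rule order.trans)
  qed
qed

end

theorem theorem3:
  fixes A :: "'a measure" and B :: "'b measure" and S :: "'s set"
    and p :: "('s, 'a, 'b) block_channel" and w :: "('s, 'a, 'b) symbol_channel"
  assumes "compound_channel A B S p" and "memoryless A B S p w"
  shows
    "(\<forall>X\<in>inputs A.
        (\<lambda>n. SUP s\<in>S. info_rate_variance A B p w X s n) \<longlonglongrightarrow> 0 \<longrightarrow>
        inf_info_rate B S p X \<le> inf_info_rate B S p (independent_version A X)) \<and>
     ((\<forall>X\<in>inputs A. (\<lambda>n. SUP s\<in>S. info_rate_variance A B p w X s n) \<longlonglongrightarrow> 0) \<longrightarrow>
        (SUP X\<in>inputs A. inf_info_rate B S p X)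
          = (SUP X\<in>memoryless_inputs A. inf_info_rate B S p X) \<and>
        (SUP X\<in>memoryless_inputs A. inf_info_rate B S p X)
          = liminf (\<lambda>n. SUP Q\<in>symbol_dists A n. INF s\<in>S.
                     (\<Sum>k<n. mutual_info (Q k) B (w s n k)) / ereal (real n)) \<and>
        (\<forall>crit. (finite_alphabets A B \<and> crit = Average_Error \<or>
                 (SUP X\<in>inputs A. inf_info_rate B S p X) \<le> compound_capacity crit A B S p) \<longrightarrow>
           compound_capacity crit A B S p
             = (SUP X\<in>memoryless_inputs A. inf_info_rate B S p X)))"
proof -
  interpret compound_memoryless A B S p w using assms by unfold_locales
  have capacity: "compound_capacity crit A B S p = (SUP X\<in>inputs A. inf_info_rate B S p X)"
    if crit: "finite_alphabets A B \<and> crit = Average_Error \<or>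
      (SUP X\<in>inputs A. inf_info_rate B S p X) \<le> compound_capacity crit A B S p" for crit
  \<comment> \<open>The converse holds for all alphabets and both criteria; only the direct part
    depends on the alternative.\<close>
  proof (rule antisym[OF compound_capacity_le])
    show "(SUP X\<in>inputs A. inf_info_rate B S p X) \<le> compound_capacity crit A B S p"
      using crit
    proof
      assume fin: "finite_alphabets A B \<and> crit = Average_Error"
      interpret finite_compound A B S p w by unfold_locales (use fin in simp)
      show ?thesis using fin le_compound_capacity by simp
    qed
  qed
  show ?thesis
  proof (intro conjI impI ballI allI)
    assume V: "\<forall>X\<in>inputs A. variance_vanishes X"
    show sup: "(SUP X\<in>inputs A. inf_info_rate B S p X) = (SUP X\<in>memoryless_inputs A. inf_info_rate B S p X)"
      using V by (intro SUP_inputs_eq_SUP_memoryless_inputs) blast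
    show "(SUP X\<in>memoryless_inputs A. inf_info_rate B S p X)
        = liminf (\<lambda>n. SUP Q\<in>symbol_dists A n. INF s\<in>S.
            (\<Sum>k<n. mutual_info (Q k) B (w s n k)) / ereal (real n))"
      using V by (intro SUP_memoryless_inputs_eq_liminf) blast
    show "compound_capacity crit A B S p = (SUP X\<in>memoryless_inputs A. inf_info_rate B S p X)"
      if "finite_alphabets A B \<and> crit = Average_Error \<or>
        (SUP X\<in>inputs A. inf_info_rate B S p X) \<le> compound_capacity crit A B S p" for crit
      using capacity[OF that] sup by (rule trans)
  qed (rule inf_info_rate_le_independent_version)
qed

end
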